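(* Let $\theta,\theta'\in[0,1]$ with $\theta>\theta'$, let $\ell_{\mathrm{sym}}:\mathbb{R}\to[0,K]$ be a symmetric loss with constant $K>0$, and let $\mathcal{G}$ be a class of functions $g:\mathcal{X}\to\mathbb{R}$. Let $X_{\mathrm{CP}}=\{x^{\mathrm{CP}}_i\}_{i=1}^{n_{\mathrm{CP}}}$ be drawn i.i.d. from $p_\theta$ and $X_{\mathrm{CN}}=\{x^{\mathrm{CN}}_j\}_{j=1}^{n_{\mathrm{CN}}}$ be drawn i.i.d. from $p_{\theta'}$, the two samples being independent. Let $\hat g\in\mathcal{G}$ be a minimizer over $\mathcal{G}$ of the empirical corrupted AUC risk $\widehat{R}^{\ell_{\mathrm{sym}}}_{\mathrm{AUC}\text{-}\mathrm{Corr}}$ and let $g^*\in\mathcal{G}$ be a minimizer over $\mathcal{G}$ of the expected clean AUC risk $R^{\ell_{\mathrm{sym}}}_{\mathrm{AUC}}$. Then for every $\delta\in(0,1)$, with probability at least $1-\delta$ over the sampling of $X_{\mathrm{CP}}$ and $X_{\mathrm{CN}}$ used to train $\hat g$, $$R^{\ell_{\mathrm{sym}}}_{\mathrm{AUC}}(\hat g)-R^{\ell_{\mathrm{sym}}}_{\mathrm{AUC}}(g^* )\le \frac{1}{\theta-\theta'}\left[K\sqrt{\frac{2(n_{\mathrm{CP}}+n_{\mathrm{CN}})\log\frac1\delta}{n_{\mathrm{CP}}\,n_{\mathrm{CN}}}}\right]+\frac{4\,\mathfrak{R}^{\mathrm{Corr}}_{n_{\mathrm{CP}},n_{\mathrm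{CN}}}(\mathcal{Q}_{\mathcal{G}}^{\ell_{\mathrm{sym}}})}{\theta-\theta'}.$$
   Context: $\mathcal{X}$ is the input space, $y\in\{-1,1\}$ is a label, and $p(x\mid y=1)$, $p(x\mid y=-1)$ are the class-conditional probability densities on $\mathcal{X}$; $\mathbb{E}_{\mathrm P}$ and $\mathbb{E}_{\mathrm N}$ denote expectations over $p(x\mid y=1)$ and $p(x\mid y=-1)$ respectively. For $\theta,\theta'\in[0,1]$ set $p_\theta(x)=\theta\,p(x\mid y=1)+(1-\theta)\,p(x\mid y=-1)$ and $p_{\theta'}(x)=\theta'\,p(x\mid y=1)+(1-\theta')\,p(x\mid y=-1)$, with expectations $\mathbb{E}_\theta$, $\mathbb{E}_{\theta'}$. A loss $\ell_{\mathrm{sym}}:\mathbb{R}\to\mathbb{R}$ is symmetric (with constant $K>0$) if $\ell_{\mathrm{sym}}(z)+\ell_{\mathrm{sym}}(-z)=K$ for all $z\in\mathbb{R}$. It is assumed throughout that $\ell_{\mathrm{sym}}$ takes values in $[0,K]$. For $g:\mathcal{X}\to\mathbb{R}$: - clean AUC risk: $R^{\ell_{\mathrm{sym}}}_{\mathrm{AUC}}(g)=\mathbb{E}_{\mathrm P}[\mathbb{E}_{\mathrm N}[\ell_{\mathrm{sym}}(g(x^{\mathrm P})-g(x^{\mathrm N}))]]$, with $x^{\mathrm P}$ and $x^{\mathrm N}$ independent; - empirical corrupted AUC risk: $\widehat{R}^{\ell_{\mathrm{sym}}}_{\mathrm{AUC}\text{-}\mathrm{Corr}}(g)=\frac{1}{n_{\mathrm{CP}}n_{\mathrm{CN}}}\sum_{i=1}^{n_{\mathrm{CP}}}\sum_{j=1}^{n_{\mathrm{CN}}}\ell_{\mathrm{sym}}(g(x^{\mathrm{CP}}_i)-g(x^{\mathrm{CN}}_j))$.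 $\mathcal{Q}_{\mathcal{G}}^{\ell_{\mathrm{sym}}}=\{Q:(x,x')\mapsto \ell_{\mathrm{sym}}(g(x)-g(x')) : g\in\mathcal{G}\}$, a class of functions from $\mathcal{X}^2$ to $[0,K]$. Bipartite Rademacher complexity: for samples $x_1,\dots,x_n$ and $x'_1,\dots,x'_m$ in $\mathcal{X}$, the empirical bipartite Rademacher complexity is $$\hat{\mathfrak{R}}_{n,m}(\mathcal{Q}_{\mathcal{G}}^{\ell_{\mathrm{sym}}})=2\,\mathbb{E}_{\sigma,\upsilon}\sup_{Q\in\mathcal{Q}_{\mathcal{G}}^{\ell_{\mathrm{sym}}}}\frac{1}{nm}\sum_{i=1}^n\sum_{j=1}^m\frac{\sigma_i+\upsilon_j}{2}\,Q(x_i,x'_j),$$ where $\sigma_1,\dots,\sigma_n,\upsilon_1,\dots,\upsilon_m$ are independent and uniform on $\{-1,+1\}$. The bipartite Rademacher complexity $\mathfrak{R}_{n,m}(\mathcal{Q}_{\mathcal{G}}^{\ell_{\mathrm{sym}}})$ is the expectation of $\hat{\mathfrak{R}}_{n,m}(\mathcal{Q}_{\mathcal{G}}^{\ell_{\mathrm{sym}}})$ over $x_1,\dots,x_n$ i.i.d. from a density $\mu$ and, independently, $x'_1,\dots,x'_m$ i.i.d. from a density $\mu'$. $\mathfrak{R}^{\mathrm{Corr}}_{n_{\mathrm{CP}},n_{\mathrm{CN}}}$ denotes this quantity with $n=n_{\mathrm{CP}}$, $m=n_{\mathrm{CN}}$, $\mu=p_\theta$, $\mu'=p_{\theta'}$.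 *)

theory Defs
  imports "HOL-Probability.Probability"
begin

text \<open>
  The input space is the space of a base measure \<open>M\<close>, and densities are taken with respect to \<open>M\<close>.
\<close>

definition prob_density :: "'a measure \<Rightarrow> ('a \<Rightarrow> real) \<Rightarrow> bool" where
  "prob_density M p \<longleftrightarrow>
     p \<in> borel_measurable M \<and> (\<forall>x\<in>space M. 0 \<le> p x) \<and> (\<integral>\<^sup>+x. ennreal (p x) \<partial>M) = 1"

definition law :: "'a measure \<Rightarrow> ('a \<Rightarrow> real) \<Rightarrow> 'a measure" where
  "law M p = density M (\<lambda>x. ennreal (p x))"

definition mixture :: "real \<Rightarrow> ('a \<Rightarrow> real) \<Rightarrow> ('a \<Rightarrow> real) \<Rightarrow> 'a \<Rightarrow> real" where
  "mixture \<theta> pP pN x = \<theta> * pP x + (1 - \<theta>) * pN x"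

text \<open>
  The joint law of two independent samples, \<open>x 0, \<dots>, x (n - 1)\<close> i.i.d. from \<open>\<mu>\<close> and
  \<open>x' 0, \<dots>, x' (m - 1)\<close> i.i.d. from \<open>\<mu>'\<close>.
\<close>

definition two_samples ::
    "nat \<Rightarrow> nat \<Rightarrow> 'a measure \<Rightarrow> 'a measure \<Rightarrow> ((nat \<Rightarrow> 'a) \<times> (nat \<Rightarrow> 'a)) measure" where
  "two_samples n m \<mu> \<mu>' = (\<Pi>\<^sub>M i\<in>{..<n}. \<mu>) \<Otimes>\<^sub>M (\<Pi>\<^sub>M j\<in>{..<m}. \<mu>')"

definition symmetric_loss :: "real \<Rightarrow> (real \<Rightarrow> real) \<Rightarrow> bool" where
  "symmetric_loss K l \<longleftrightarrow> (\<forall>z. l z + l (- z) = K)"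

definition auc_risk ::
    "'a measure \<Rightarrow> 'a measure \<Rightarrow> (real \<Rightarrow> real) \<Rightarrow> ('a \<Rightarrow> real) \<Rightarrow> real" where
  "auc_risk P N l g = (\<integral>xP. (\<integral>xN. l (g xP - g xN) \<partial>N) \<partial>P)"

definition empirical_auc_risk ::
    "nat \<Rightarrow> nat \<Rightarrow> (real \<Rightarrow> real) \<Rightarrow> (nat \<Rightarrow> 'a) \<times> (nat \<Rightarrow> 'a) \<Rightarrow> ('a \<Rightarrow> real) \<Rightarrow> real" where
  "empirical_auc_risk n m l s g =
     1 / (real n * real m) * (\<Sum>i<n. \<Sum>j<m. l (g (fst s i) - g (snd s j)))"

definition loss_class :: "(real \<Rightarrow> real) \<Rightarrow> ('a \<Rightarrow> real) set \<Rightarrow> ('a \<times> 'a \<Rightarrow> real) set" where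
  "loss_class l G = {Q. \<exists>g\<in>G. Q = (\<lambda>(x, x'). l (g x - g x'))}"

text \<open>
  Each \<open>Pi_pmf\<close> is a family of independent uniform signs; its second argument is merely the
  value outside the index range, which is never used.
\<close>

definition rademacher_signs :: "nat \<Rightarrow> (nat \<Rightarrow> real) pmf" where
  "rademacher_signs n = Pi_pmf {..<n} 0 (\<lambda>_. pmf_of_set {-1, 1})"

definition bipartite_sup ::
    "nat \<Rightarrow> nat \<Rightarrow> ('a \<times> 'a \<Rightarrow> real) set \<Rightarrow> (nat \<Rightarrow> real) \<Rightarrow> (nat \<Rightarrow> real) \<Rightarrow>
     (nat \<Rightarrow> 'a) \<times> (nat \<Rightarrow> 'a) \<Rightarrow> real" where
  "bipartite_sup n m \<Q> \<sigma> \<upsilon> s =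
     (SUP Q\<in>\<Q>. 1 / (real n * real m) *
        (\<Sum>i<n. \<Sum>j<m. (\<sigma> i + \<upsilon> j) / 2 * Q (fst s i, snd s j)))"

definition empirical_bipartite_rademacher ::
    "nat \<Rightarrow> nat \<Rightarrow> ('a \<times> 'a \<Rightarrow> real) set \<Rightarrow> (nat \<Rightarrow> 'a) \<times> (nat \<Rightarrow> 'a) \<Rightarrow> real" where
  "empirical_bipartite_rademacher n m \<Q> s =
     2 * measure_pmf.expectation (pair_pmf (rademacher_signs n) (rademacher_signs m))
           (\<lambda>(\<sigma>, \<upsilon>). bipartite_sup n m \<Q> \<sigma> \<upsilon> s)"

definition bipartite_rademacher ::
    "nat \<Rightarrow> nat \<Rightarrow> 'a measure \<Rightarrow> 'a measure \<Rightarrow> ('a \<times> 'a \<Rightarrow> real) set \<Rightarrow> real" where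
  "bipartite_rademacher n m \<mu> \<mu>' \<Q> =
     (\<integral>s. empirical_bipartite_rademacher n m \<Q> s \<partial>two_samples n m \<mu> \<mu>')"

text \<open>
  The supremum over a possibly uncountable class need not be measurable, in which case the Bochner
  integral in \<open>bipartite_rademacher\<close> has no meaning (it defaults to 0). This predicate states that
  the integrand is measurable for each realisation of the signs, so that the expectation exists.
\<close>

definition bipartite_rademacher_well_defined ::
    "nat \<Rightarrow> nat \<Rightarrow> 'a measure \<Rightarrow> 'a measure \<Rightarrow> ('a \<times> 'a \<Rightarrow> real) set \<Rightarrow> bool" where
  "bipartite_rademacher_well_defined n m \<mu> \<mu>' \<Q> \<longleftrightarrow>
     (\<forall>\<sigma>\<in>{..<n} \<rightarrow> {-1, 1}. \<forall>\<upsilon>\<in>{..<m} \<rightarrow> {-1, 1}.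
        bipartite_sup n m \<Q> \<sigma> \<upsilon> \<in> borel_measurable (two_samples n m \<mu> \<mu>'))"

end

theory Submission
  imports Defs
begin

text \<open>
  By symmetry of the loss, the corrupted AUC risk equals \<open>\<theta> - \<theta>'\<close> times the clean one plus a
  constant. Since \<open>ghat\<close> minimizes the empirical corrupted risk, its corrupted excess risk over \<open>gstar\<close>
  is at most the deviation (expected minus empirical risk) at \<open>ghat\<close> minus the one at \<open>gstar\<close>.

  The supremum over \<open>G\<close> of the deviations need not be measurable, since only the signed suprema inside the
  Rademacher complexity are assumed to be. It is therefore replaced by a measurable upper bound: the
  average, over a ghost sample and over random signs, of signed suprema evaluated at points selected by
  the signs from the sample and the ghost sample. This bound has expectation twice the bipartite
  Rademacher complexity and the same bounded differences as the empirical risk, so McDiarmid's inequality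
  applies to it, together with the deviation at \<open>gstar\<close>, with exactly the required constant.
\<close>

section \<open>McDiarmid's inequality\<close>

text \<open>The normalisation is that of Hoeffding's lemma: a variable confined to an interval of
  length \<open>c\<close> satisfies this with \<open>v = c\<^sup>2\<close>. The nonnegative integral
  spares any integrability proof for the exponential. Positive \<open>t\<close> covers the upper
  tail.\<close>

definition subgaussian_mgf :: "'a measure \<Rightarrow> ('a \<Rightarrow> real) \<Rightarrow> real \<Rightarrow> bool" where
  "subgaussian_mgf M f v \<longleftrightarrow>
     (\<forall>t>0. (\<integral>\<^sup>+x. exp (t * (f x - (\<integral>y. f y \<partial>M))) \<partial>M) \<le> ennreal (exp (t\<^sup>2 * v / 8)))"

text \<open>Bounded oscillation places all values of \<open>f\<close> between its infimum
  \<open>a\<close> and \<open>a + c\<close>, where Hoeffding's lemma applies.\<close>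

lemma subgaussian_mgf_oscillation:
  fixes f :: "'a \<Rightarrow> real"
  assumes "prob_space M" and f: "f \<in> borel_measurable M"
    and osc: "\<And>x y. x \<in> space M \<Longrightarrow> y \<in> space M \<Longrightarrow> \<bar>f x - f y\<bar> \<le> c"
  shows "subgaussian_mgf M f (c\<^sup>2)"
proof -
  interpret prob_space M by fact
  obtain x0 where x0: "x0 \<in> space M" using not_empty by auto
  define a where "a = (INF x\<in>space M. f x)"
  have bdd: "bdd_below (f ` space M)"
    by (rule bdd_belowI[of _ "f x0 - c"]) (use osc[OF x0] in force)
  have le: "a \<le> f x" if "x \<in> space M" for x
    unfolding a_def by (rule cINF_lower[OF bdd that])
  have ge: "f x \<le> a + c" if "x \<in> space M" for x
  proof -
    have "f x - c \<le> a"
      unfolding a_def by (rule cINF_greatest) (use x0 osc[OF that] in force)+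
    then show ?thesis by simp
  qed
  interpret interval_bounded_random_variable M f a "a + c"
    by unfold_locales (use f le ge in auto)
  show ?thesis
    unfolding subgaussian_mgf_def using Hoeffdings_lemma_nn_integral by simp
qed

text \<open>The martingale step behind McDiarmid's inequality. With \<open>h b\<close> the mean of
  \<open>f\<close> over the first component, write f - E f as (f - h) + (h - E h). The inner
  hypothesis controls the first part uniformly in \<open>b\<close>, the outer one controls the
  second, and the two exponents add.\<close>

lemma subgaussian_mgf_pair:
  fixes f :: "'a \<times> 'b \<Rightarrow> real"
  assumes "prob_space A" "prob_space B" and f[measurable]: "f \<in> borel_measurable (A \<Otimes>\<^sub>M B)"
    and bound: "\<And>z. z \<in> space (A \<Otimes>\<^sub>M B) \<Longrightarrow> \<bar>f z\<bar> \<le> C"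
    and inner: "\<And>b. b \<in> space B \<Longrightarrow> subgaussian_mgf A (\<lambda>a. f (a, b)) v"
    and outer: "subgaussian_mgf B (\<lambda>b. \<integral>a. f (a, b) \<partial>A) w"
  shows "subgaussian_mgf (A \<Otimes>\<^sub>M B) f (v + w)"
  unfolding subgaussian_mgf_def
proof (intro allI impI)
  fix t :: real assume t: "t > 0"
  interpret A: prob_space A by fact
  interpret B: prob_space B by fact
  interpret pair_prob_space A B ..
  define h where "h b = (\<integral>a. f (a, b) \<partial>A)" for b
  have h[measurable]: "h \<in> borel_measurable B"
    unfolding h_def by measurable
  have int: "integrable (A \<Otimes>\<^sub>M B) f"
    by (rule integrable_const_bound[of _ C]) (use bound f in auto)
  have mean: "(\<integral>z. f z \<partial>(A \<Otimes>\<^sub>M B)) = (\<integral>b. h b \<partial>B)"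
    unfolding h_def using integral_snd[of "\<lambda>a b. f (a, b)"] int by simp
  let ?m = "\<integral>b. h b \<partial>B"
  have "(\<integral>\<^sup>+z. exp (t * (f z - ?m)) \<partial>(A \<Otimes>\<^sub>M B))
      = (\<integral>\<^sup>+b. (\<integral>\<^sup>+a. exp (t * (f (a, b) - ?m)) \<partial>A) \<partial>B)"
    by (rule nn_integral_snd[symmetric]) measurable
  \<comment> \<open>The exponent is split at the conditional mean \<open>h b\<close>; the factor
    depending on \<open>b\<close> alone leaves the inner integral.\<close>
  also have "\<dots> = (\<integral>\<^sup>+b. exp (t * (h b - ?m)) * (\<integral>\<^sup>+a. exp (t * (f (a, b) - h b)) \<partial>A) \<partial>B)"
  proof (rule nn_integral_cong)
    fix b assume [measurable]: "b \<in> space B"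
    have "(\<integral>\<^sup>+a. exp (t * (f (a, b) - ?m)) \<partial>A)
      = (\<integral>\<^sup>+a. ennreal (exp (t * (h b - ?m))) * ennreal (exp (t * (f (a, b) - h b))) \<partial>A)"
      by (simp add: algebra_simps flip: ennreal_mult exp_add)
    also have "\<dots> = exp (t * (h b - ?m)) * (\<integral>\<^sup>+a. exp (t * (f (a, b) - h b)) \<partial>A)"
      by (rule nn_integral_cmult) measurable
    finally show "(\<integral>\<^sup>+a. exp (t * (f (a, b) - ?m)) \<partial>A)
        = exp (t * (h b - ?m)) * (\<integral>\<^sup>+a. exp (t * (f (a, b) - h b)) \<partial>A)" .
  qed
  also have "\<dots> \<le> (\<integral>\<^sup>+b. exp (t * (h b - ?m)) * ennreal (exp (t\<^sup>2 * v / 8)) \<partial>B)"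
    by (intro nn_integral_mono mult_left_mono)
      (use inner t in \<open>auto simp: subgaussian_mgf_def h_def\<close>)
  also have "\<dots> = (\<integral>\<^sup>+b. exp (t * (h b - ?m)) \<partial>B) * ennreal (exp (t\<^sup>2 * v / 8))"
    by (rule nn_integral_multc) measurable
  also have "\<dots> \<le> ennreal (exp (t\<^sup>2 * w / 8)) * ennreal (exp (t\<^sup>2 * v / 8))"
    by (intro mult_right_mono) (use outer t in \<open>auto simp: subgaussian_mgf_def h_def\<close>)
  also have "\<dots> = ennreal (exp (t\<^sup>2 * (v + w) / 8))"
    by (simp add: algebra_simps add_divide_distrib flip: ennreal_mult exp_add)
  finally show "(\<integral>\<^sup>+z. exp (t * (f z - (\<integral>y. f y \<partial>(A \<Otimes>\<^sub>M B)))) \<partial>(A \<Otimes>\<^sub>M B))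
      \<le> ennreal (exp (t\<^sup>2 * (v + w) / 8))"
    by (simp add: mean)
qed

lemma (in prob_space) integral_diff_abs_le:
  fixes f g :: "'a \<Rightarrow> real"
  assumes "integrable M f" "integrable M g" "\<And>x. x \<in> space M \<Longrightarrow> \<bar>f x - g x\<bar> \<le> c"
  shows "\<bar>(\<integral>x. f x \<partial>M) - (\<integral>x. g x \<partial>M)\<bar> \<le> c"
proof -
  have "\<bar>(\<integral>x. f x \<partial>M) - (\<integral>x. g x \<partial>M)\<bar> = \<bar>\<integral>x. f x - g x \<partial>M\<bar>"
    using assms by simp
  also have "\<dots> \<le> (\<integral>x. \<bar>f x - g x\<bar> \<partial>M)"
    by (rule integral_abs_bound)
  also have "\<dots> \<le> (\<integral>x. c \<partial>M)"
    using assms by (intro integral_mono) auto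
  finally show ?thesis by (simp add: prob_space)
qed

lemma (in prob_space) integral_abs_le_const:
  fixes f :: "'a \<Rightarrow> real"
  assumes "f \<in> borel_measurable M" "\<And>x. x \<in> space M \<Longrightarrow> \<bar>f x\<bar> \<le> C"
  shows "\<bar>\<integral>x. f x \<partial>M\<bar> \<le> C"
proof -
  have "integrable M f"
    by (rule integrable_const_bound[of _ C]) (use assms in auto)
  from integral_diff_abs_le[OF this integrable_const[of 0]] assms(2) show ?thesis by simp
qed

text \<open>Induction on the index set, peeling off one coordinate \<open>i\<close> at a time. With
  the others fixed, \<open>f\<close> oscillates by at most \<open>c i\<close> in it; averaging over
  it preserves the bound and the differences \<open>c j\<close> in the remaining coordinates, so the
  induction hypothesis applies to the average.\<close>

lemma mcdiarmid_subgaussian_mgf: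
  fixes f :: "('i \<Rightarrow> 'a) \<Rightarrow> real"
  assumes "finite I" and "\<And>i. i \<in> I \<Longrightarrow> prob_space (M i)"
    and "f \<in> borel_measurable (PiM I M)"
    and "\<And>x. x \<in> space (PiM I M) \<Longrightarrow> \<bar>f x\<bar> \<le> C"
    and "\<And>i x y. i \<in> I \<Longrightarrow> x \<in> space (PiM I M) \<Longrightarrow> y \<in> space (M i) \<Longrightarrow>
           \<bar>f (x(i := y)) - f x\<bar> \<le> c i"
  shows "subgaussian_mgf (PiM I M) f (\<Sum>i\<in>I. (c i)\<^sup>2)"
  using assms
proof (induction I arbitrary: f rule: finite_induct)
  case empty
  \<comment> \<open>The product over no coordinates has a single point, so the oscillation is
    0.\<close>
  have "subgaussian_mgf (PiM {} M) f (0\<^sup>2)"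
    by (rule subgaussian_mgf_oscillation)
      (use empty in \<open>auto intro!: prob_space_PiM simp: space_PiM\<close>)
  then show ?case by simp
next
  case (insert i I)
  let ?P = "PiM I M" and ?P' = "PiM (insert i I) M"
  interpret Mi: prob_space "M i" using insert.prems by simp
  interpret P: prob_space ?P using insert.prems by (intro prob_space_PiM) auto
  \<comment> \<open>\<open>u\<close> inserts the new coordinate; it transports the pair measure to
    the larger product, which makes \<open>subgaussian_mgf_pair\<close> applicable.\<close>
  define u where "u = (\<lambda>(y, x :: 'i \<Rightarrow> 'a). x(i := y))"
  have u[measurable]: "u \<in> M i \<Otimes>\<^sub>M ?P \<rightarrow>\<^sub>M ?P'"
    unfolding u_def split_beta by (rule measurable_fun_upd[where J = I]) auto
  note f[measurable] = insert.prems(2)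
  have distr: "distr (M i \<Otimes>\<^sub>M ?P) ?P' u = ?P'"
    unfolding u_def by (rule distr_pair_PiM_eq_PiM) (use insert.prems in auto)
  have upd: "x(i := y) \<in> space ?P'" if "x \<in> space ?P" "y \<in> space (M i)" for x y
    using measurable_space[OF u, of "(y, x)"] that by (simp add: u_def space_pair_measure)
  have fu[measurable]: "(\<lambda>z. f (u z)) \<in> borel_measurable (M i \<Otimes>\<^sub>M ?P)"
    by measurable
  have fy[measurable]: "(\<lambda>y. f (x(i := y))) \<in> borel_measurable (M i)" if "x \<in> space ?P" for x
    using measurable_compose[OF measurable_Pair2'[OF that] fu] by (simp add: u_def)
  have fint: "integrable (M i) (\<lambda>y. f (x(i := y)))" if "x \<in> space ?P" for x
    by (rule Mi.integrable_const_bound[of _ C]) (use insert.prems(3) upd fy that in auto)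
  have "subgaussian_mgf (M i \<Otimes>\<^sub>M ?P) (\<lambda>z. f (u z)) ((c i)\<^sup>2 + (\<Sum>j\<in>I. (c j)\<^sup>2))"
  proof (rule subgaussian_mgf_pair)
    show "\<bar>f (u z)\<bar> \<le> C" if "z \<in> space (M i \<Otimes>\<^sub>M ?P)" for z
      using measurable_space[OF u that] insert.prems(3) by auto
    show "subgaussian_mgf (M i) (\<lambda>y. f (u (y, x))) ((c i)\<^sup>2)" if x: "x \<in> space ?P" for x
    proof (rule subgaussian_mgf_oscillation)
      show "\<bar>f (u (y, x)) - f (u (z, x))\<bar> \<le> c i"
        if "y \<in> space (M i)" "z \<in> space (M i)" for y z
      proof -
        \<comment> \<open>The hypothesis compares a point of the larger product with its update.
          Since \<open>x\<close> has no coordinate \<open>i\<close> yet, \<open>z\<close> fills it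
          first and is then overwritten by \<open>y\<close>.\<close>
        have "\<bar>f ((x(i := z))(i := y)) - f (x(i := z))\<bar> \<le> c i"
          by (rule insert.prems(4)[OF insertI1 upd[OF x that(2)] that(1)])
        then show ?thesis unfolding u_def fun_upd_upd prod.case .
      qed
    qed (use fy[OF x] Mi.prob_space_axioms in \<open>simp_all add: u_def\<close>)
    show "subgaussian_mgf ?P (\<lambda>x. \<integral>y. f (u (y, x)) \<partial>M i) (\<Sum>j\<in>I. (c j)\<^sup>2)"
    proof (rule insert.IH)
      show "(\<lambda>x. \<integral>y. f (u (y, x)) \<partial>M i) \<in> borel_measurable ?P"
        by measurable
      show "\<bar>\<integral>y. f (u (y, x)) \<partial>M i\<bar> \<le> C" if "x \<in> space ?P" for x
        using fy[OF that] upd[OF that] insert.prems(3)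
        by (intro Mi.integral_abs_le_const) (auto simp: u_def)
      show "\<bar>(\<integral>z. f (u (z, x(j := y))) \<partial>M i) - (\<integral>z. f (u (z, x)) \<partial>M i)\<bar> \<le> c j"
        if j: "j \<in> I" and x: "x \<in> space ?P" and y: "y \<in> space (M j)" for j x y
      proof -
        have x': "x(j := y) \<in> space ?P"
          using x y j by (auto simp: space_PiM PiE_iff extensional_def)
        have "j \<noteq> i" using j insert.hyps by auto
        \<comment> \<open>Updates at distinct coordinates commute, so the bound for coordinate
          \<open>j\<close> holds for each value \<open>z\<close> of the averaged coordinate.\<close>
        have "\<bar>f ((x(j := y))(i := z)) - f (x(i := z))\<bar> \<le> c j" if z: "z \<in> space (M i)" for z
          unfolding fun_upd_twist[OF \<open>j \<noteq> i\<close>]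
          by (rule insert.prems(4)[OF insertI2[OF j] upd[OF x z] y])
        from Mi.integral_diff_abs_le[OF fint[OF x'] fint[OF x] this] show ?thesis
          unfolding u_def prod.case .
      qed
    qed (use insert.prems in auto)
  qed (use Mi.prob_space_axioms P.prob_space_axioms fu in auto)
  then have "subgaussian_mgf (distr (M i \<Otimes>\<^sub>M ?P) ?P' u) f ((c i)\<^sup>2 + (\<Sum>j\<in>I. (c j)\<^sup>2))"
    unfolding subgaussian_mgf_def by (simp add: nn_integral_distr integral_distr)
  then show ?case
    using insert.hyps by (simp add: distr)
qed

text \<open>McDiarmid's bound is applied to each sample separately: to \<open>f\<close> with the
  second sample fixed, and to the average of \<open>f\<close> over the first sample, which inherits
  the differences \<open>b\<close>. The pair lemma joins the two.\<close>

lemma mcdiarmid_two_samples: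
  fixes f :: "(nat \<Rightarrow> 'a) \<times> (nat \<Rightarrow> 'b) \<Rightarrow> real"
  assumes \<mu>: "prob_space \<mu>" and \<nu>: "prob_space \<nu>"
    and f[measurable]: "f \<in> borel_measurable ((\<Pi>\<^sub>M i\<in>{..<n}. \<mu>) \<Otimes>\<^sub>M (\<Pi>\<^sub>M j\<in>{..<m}. \<nu>))"
    and bound: "\<And>s. s \<in> space ((\<Pi>\<^sub>M i\<in>{..<n}. \<mu>) \<Otimes>\<^sub>M (\<Pi>\<^sub>M j\<in>{..<m}. \<nu>)) \<Longrightarrow> \<bar>f s\<bar> \<le> C"
    and diff1: "\<And>i x x' y. i < n \<Longrightarrow> x \<in> space (\<Pi>\<^sub>M i\<in>{..<n}. \<mu>) \<Longrightarrow>
      x' \<in> space (\<Pi>\<^sub>M j\<in>{..<m}. \<nu>) \<Longrightarrow> y \<in> space \<mu> \<Longrightarrow> \<bar>f (x(i := y), x') - f (x, x')\<bar> \<le> a"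
    and diff2: "\<And>j x x' y. j < m \<Longrightarrow> x \<in> space (\<Pi>\<^sub>M i\<in>{..<n}. \<mu>) \<Longrightarrow>
      x' \<in> space (\<Pi>\<^sub>M j\<in>{..<m}. \<nu>) \<Longrightarrow> y \<in> space \<nu> \<Longrightarrow> \<bar>f (x, x'(j := y)) - f (x, x')\<bar> \<le> b"
  shows "subgaussian_mgf ((\<Pi>\<^sub>M i\<in>{..<n}. \<mu>) \<Otimes>\<^sub>M (\<Pi>\<^sub>M j\<in>{..<m}. \<nu>)) f
    (real n * a\<^sup>2 + real m * b\<^sup>2)"
proof (rule subgaussian_mgf_pair)
  let ?P = "\<Pi>\<^sub>M i\<in>{..<n}. \<mu>" and ?Q = "\<Pi>\<^sub>M j\<in>{..<m}. \<nu>"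
  interpret P: prob_space ?P by (rule prob_space_PiM) (rule \<mu>)
  interpret Q: prob_space ?Q by (rule prob_space_PiM) (rule \<nu>)
  show "prob_space ?P" "prob_space ?Q"
    by (rule P.prob_space_axioms, rule Q.prob_space_axioms)
  show "f \<in> borel_measurable (?P \<Otimes>\<^sub>M ?Q)" by (rule f)
  show "\<And>s. s \<in> space (?P \<Otimes>\<^sub>M ?Q) \<Longrightarrow> \<bar>f s\<bar> \<le> C" by (rule bound)
  have fx: "(\<lambda>x. f (x, x')) \<in> borel_measurable ?P" if "x' \<in> space ?Q" for x'
    using that by measurable
  have fint: "integrable ?P (\<lambda>x. f (x, x'))" if "x' \<in> space ?Q" for x'
    by (rule P.integrable_const_bound[of _ C])
      (use fx bound that in \<open>auto simp: space_pair_measure\<close>)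
  show "subgaussian_mgf ?P (\<lambda>x. f (x, x')) (real n * a\<^sup>2)" if x': "x' \<in> space ?Q" for x'
    using mcdiarmid_subgaussian_mgf[of "{..<n}" "\<lambda>_. \<mu>" "\<lambda>x. f (x, x')" C "\<lambda>_. a"]
      \<mu> fx[OF x'] bound diff1 x' by (auto simp: space_pair_measure)
  have "subgaussian_mgf ?Q (\<lambda>x'. \<integral>x. f (x, x') \<partial>?P) (\<Sum>j<m. b\<^sup>2)"
  proof (rule mcdiarmid_subgaussian_mgf)
    show "(\<lambda>x'. \<integral>x. f (x, x') \<partial>?P) \<in> borel_measurable ?Q"
      by measurable
    show "\<bar>\<integral>x. f (x, x') \<partial>?P\<bar> \<le> C" if "x' \<in> space ?Q" for x'
      using fx[OF that] bound that
      by (intro P.integral_abs_le_const) (auto simp: space_pair_measure)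
    show "\<bar>(\<integral>x. f (x, x'(j := y)) \<partial>?P) - (\<integral>x. f (x, x') \<partial>?P)\<bar> \<le> b"
      if "j \<in> {..<m}" "x' \<in> space ?Q" "y \<in> space \<nu>" for j x' y
    proof -
      have "x'(j := y) \<in> space ?Q"
        using that by (auto simp: space_PiM PiE_iff extensional_def)
      then show ?thesis
        using that fint diff2 by (intro P.integral_diff_abs_le) auto
    qed
  qed (use \<nu> in auto)
  then show "subgaussian_mgf ?Q (\<lambda>x'. \<integral>x. f (x, x') \<partial>?P) (real m * b\<^sup>2)"
    by simp
qed

text \<open>Chernoff's method with the optimal parameter, solved for the radius at which the failure
  probability is \<delta>.\<close>

lemma (in prob_space) subgaussian_mgf_tail:
  assumes mgf: "subgaussian_mgf M f v" and [measurable]: "f \<in> borel_measurable M"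
    and "v > 0" "\<delta> \<in> {0<..<1}"
  shows "prob {x\<in>space M. f x \<le> expectation f + sqrt (v * ln (1 / \<delta>) / 2)} \<ge> 1 - \<delta>"
proof -
  define \<epsilon> where "\<epsilon> = sqrt (v * ln (1 / \<delta>) / 2)"
  \<comment> \<open>This \<open>t\<close> minimizes -t \<epsilon> + t^2 v / 8. The minimum is -2
    \<epsilon>^2 / v, which equals ln \<delta> by the choice of \<epsilon>.\<close>
  define t where "t = 4 * \<epsilon> / v"
  have L: "ln (1 / \<delta>) > 0" using assms by simp
  have \<epsilon>: "\<epsilon> > 0" "\<epsilon>\<^sup>2 = v * ln (1 / \<delta>) / 2"
    unfolding \<epsilon>_def using L \<open>v > 0\<close> by auto
  have t: "t > 0" using \<epsilon> \<open>v > 0\<close> by (simp add: t_def)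
  let ?X = "\<lambda>x. f x - expectation f"
  have "ennreal (prob {x\<in>space M. ?X x \<ge> \<epsilon>}) = emeasure M {x\<in>space M. ?X x \<ge> \<epsilon>}"
    by (simp add: emeasure_eq_measure)
  also have "\<dots> \<le> ennreal (exp (- t * \<epsilon>)) * (\<integral>\<^sup>+x\<in>space M. exp (t * ?X x) \<partial>M)"
    by (intro Chernoff_ineq_nn_integral_ge t) auto
  also have "(\<integral>\<^sup>+x\<in>space M. exp (t * ?X x) \<partial>M) = (\<integral>\<^sup>+x. exp (t * ?X x) \<partial>M)"
    by (intro nn_integral_cong) auto
  also have "ennreal (exp (- t * \<epsilon>)) * (\<integral>\<^sup>+x. exp (t * ?X x) \<partial>M)
      \<le> ennreal (exp (- t * \<epsilon>)) * ennreal (exp (t\<^sup>2 * v / 8))"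
    using mgf t by (intro mult_left_mono) (auto simp: subgaussian_mgf_def)
  also have "\<dots> = ennreal (exp (- (2 * \<epsilon>\<^sup>2 / v)))"
    using \<open>v > 0\<close> by (simp add: t_def power2_eq_square field_simps flip: ennreal_mult exp_add)
  also have "exp (- (2 * \<epsilon>\<^sup>2 / v)) = \<delta>"
    using \<open>v > 0\<close> assms unfolding \<epsilon>(2) by (simp add: ln_div)
  finally have le: "prob {x\<in>space M. ?X x \<ge> \<epsilon>} \<le> \<delta>"
    using assms by simp
  have "1 - \<delta> \<le> 1 - prob {x\<in>space M. ?X x \<ge> \<epsilon>}" using le by simp
  also have "\<dots> = prob (space M - {x\<in>space M. ?X x \<ge> \<epsilon>})"
    by (rule prob_compl[symmetric]) measurable
  also have "\<dots> \<le> prob {x\<in>space M. f x \<le> expectation f + \<epsilon>}"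
    by (rule finite_measure_mono) auto
  finally show ?thesis by (simp add: \<epsilon>_def)
qed

section \<open>Corrupted and clean AUC risk\<close>

lemma integral_law:
  fixes f :: "'a \<Rightarrow> real"
  assumes "prob_density M p" "f \<in> borel_measurable M"
  shows "(\<integral>x. f x \<partial>law M p) = (\<integral>x. p x * f x \<partial>M)"
  using assms unfolding law_def prob_density_def by (subst integral_density) auto

lemma prob_space_law:
  assumes "prob_density M p"
  shows "prob_space (law M p)"
  using assms unfolding law_def prob_density_def
  by (intro prob_spaceI) (simp add: emeasure_density cong: nn_integral_cong)

lemma sets_law [simp, measurable_cong]: "sets (law M p) = sets M"
  by (simp add: law_def)

lemma space_law [simp]: "space (law M p) = space M"
  by (simp add: law_def)

lemma prob_density_mixture:
  assumes "prob_density M p" "prob_density M q" "\<theta> \<in> {0..1}"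
  shows "prob_density M (mixture \<theta> p q)"
proof -
  note [measurable] = assms(1,2)[unfolded prob_density_def, THEN conjunct1]
  have "(\<integral>\<^sup>+x. ennreal (mixture \<theta> p q x) \<partial>M)
      = (\<integral>\<^sup>+x. ennreal \<theta> * ennreal (p x) + ennreal (1 - \<theta>) * ennreal (q x) \<partial>M)"
    using assms by (intro nn_integral_cong)
      (simp add: mixture_def prob_density_def flip: ennreal_mult ennreal_plus)
  also have "\<dots> = ennreal \<theta> * (\<integral>\<^sup>+x. p x \<partial>M) + ennreal (1 - \<theta>) * (\<integral>\<^sup>+x. q x \<partial>M)"
    by (subst nn_integral_add) (simp_all add: nn_integral_cmult)
  also have "\<dots> = 1"
    using assms by (simp add: prob_density_def flip: ennreal_plus)
  finally show ?thesis
    using assms by (auto simp: prob_density_def mixture_def[abs_def])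
qed

text \<open>Boundedness of \<open>f\<close> gives integrability under both laws, so that the Bochner
  integral splits along the mixture.\<close>

lemma integral_law_mixture:
  fixes f :: "'a \<Rightarrow> real"
  assumes p: "prob_density M p" and q: "prob_density M q" and "\<theta> \<in> {0..1}"
    and f: "f \<in> borel_measurable M" and bound: "\<And>x. x \<in> space M \<Longrightarrow> \<bar>f x\<bar> \<le> C"
  shows "(\<integral>x. f x \<partial>law M (mixture \<theta> p q))
    = \<theta> * (\<integral>x. f x \<partial>law M p) + (1 - \<theta>) * (\<integral>x. f x \<partial>law M q)"
proof -
  have int: "integrable M (\<lambda>x. r x * f x)" if r: "prob_density M r" for r
  proof -
    interpret prob_space "law M r" by (rule prob_space_law[OF r])
    have "integrable (law M r) f"
      by (rule integrable_const_bound[of _ C]) (use f bound in \<open>auto simp: law_def\<close>)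
    then show ?thesis
      using r f unfolding law_def prob_density_def by (subst (asm) integrable_density) auto
  qed
  have "(\<integral>x. mixture \<theta> p q x * f x \<partial>M)
      = (\<integral>x. \<theta> * (p x * f x) + (1 - \<theta>) * (q x * f x) \<partial>M)"
    by (intro Bochner_Integration.integral_cong) (auto simp: mixture_def algebra_simps)
  also have "\<dots> = \<theta> * (\<integral>x. p x * f x \<partial>M) + (1 - \<theta>) * (\<integral>x. q x * f x \<partial>M)"
    using int[OF p] int[OF q] by simp
  finally show ?thesis
    using assms by (simp add: integral_law prob_density_mixture)
qed

text \<open>Symmetry turns each loss value into \<open>K\<close> minus the loss of the exchanged
  pair, and Fubini restores the order of integration. For \<open>A = B\<close> this forces the risk
  to be K / 2.\<close>

lemma auc_risk_swap:
  assumes "prob_space A" "prob_space B" and sets: "sets A = sets M" "sets B = sets M"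
    and g[measurable]: "g \<in> borel_measurable M" and l[measurable]: "l \<in> borel_measurable borel"
    and sym: "symmetric_loss K l" and rng: "\<And>z. l z \<in> {0..K}"
  shows "auc_risk B A l g = K - auc_risk A B l g"
proof -
  interpret A: prob_space A by fact
  interpret B: prob_space B by fact
  interpret pair_prob_space A B ..
  note [measurable_cong] = sets
  have meas: "(\<lambda>(x, y). l (g x - g y)) \<in> borel_measurable (A \<Otimes>\<^sub>M B)"
    by measurable
  have int: "integrable (A \<Otimes>\<^sub>M B) (\<lambda>(x, y). l (g x - g y))"
    by (rule integrable_const_bound[of _ K]) (use rng meas in auto)
  have l_swap: "l (g y - g x) = K - l (g x - g y)" for x y
    using sym by (metis symmetric_loss_def add_diff_cancel_left' minus_diff_eq)
  have inner: "integrable B (\<lambda>y. l (g x - g y))" if "x \<in> space A" for x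
    by (rule B.integrable_const_bound[of _ K]) (use rng that in auto)
  have inner': "integrable A (\<lambda>x. l (g x - g y))" if "y \<in> space B" for y
    by (rule A.integrable_const_bound[of _ K]) (use rng that in auto)
  have outer: "integrable B (\<lambda>y. \<integral>x. l (g x - g y) \<partial>A)"
    using integrable_snd[of "\<lambda>x y. l (g x - g y)"] int by simp
  have "auc_risk B A l g = (\<integral>y. (\<integral>x. K - l (g x - g y) \<partial>A) \<partial>B)"
    unfolding auc_risk_def by (intro Bochner_Integration.integral_cong refl l_swap)
  also have "\<dots> = (\<integral>y. K - (\<integral>x. l (g x - g y) \<partial>A) \<partial>B)"
    using inner' by (intro Bochner_Integration.integral_cong) (auto simp: A.prob_space)
  also have "\<dots> = K - (\<integral>y. (\<integral>x. l (g x - g y) \<partial>A) \<partial>B)"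
    using outer by (simp add: B.prob_space)
  also have "(\<integral>y. (\<integral>x. l (g x - g y) \<partial>A) \<partial>B) = auc_risk A B l g"
    unfolding auc_risk_def by (rule Fubini_integral[OF int])
  finally show ?thesis .
qed

text \<open>The risk is bilinear in the two laws, so the mixtures expand into four risks. Those of a
  law against itself are K / 2, and N against P is \<open>K\<close> minus P against N. The latter
  thus gets the coefficient \<theta> (1 - \<theta>') - \<theta>' (1 - \<theta>) = \<theta> -
  \<theta>'; the rest is constant in \<open>g\<close>.\<close>

lemma auc_risk_mixture:
  assumes p: "prob_density M p" and q: "prob_density M q"
    and \<theta>: "\<theta> \<in> {0..1}" "\<theta>' \<in> {0..1}"
    and g[measurable]: "g \<in> borel_measurable M" and l[measurable]: "l \<in> borel_measurable borel"
    and sym: "symmetric_loss K l" and rng: "\<And>z. l z \<in> {0..K}"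
  shows "auc_risk (law M (mixture \<theta> p q)) (law M (mixture \<theta>' p q)) l g
    = (\<theta> - \<theta>') * auc_risk (law M p) (law M q) l g + (1 - \<theta> + \<theta>') * K / 2"
proof -
  let ?P = "law M p" and ?N = "law M q"
  let ?R = "\<lambda>A B. auc_risk A B l g"
  have abs_le: "\<bar>l z\<bar> \<le> K" for z using rng[of z] by auto
  have outer: "(\<lambda>x. \<integral>y. l (g x - g y) \<partial>law M r) \<in> borel_measurable M"
    "\<And>x. x \<in> space M \<Longrightarrow> \<bar>\<integral>y. l (g x - g y) \<partial>law M r\<bar> \<le> K"
    if "prob_density M r" for r
  proof -
    interpret prob_space "law M r" using that by (rule prob_space_law)
    show "(\<lambda>x. \<integral>y. l (g x - g y) \<partial>law M r) \<in> borel_measurable M"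
      by measurable
    show "\<bar>\<integral>y. l (g x - g y) \<partial>law M r\<bar> \<le> K" if "x \<in> space M" for x
      by (rule integral_abs_le_const) (use abs_le in auto)
  qed
  have "(\<integral>y. l (g x - g y) \<partial>law M (mixture \<theta>' p q))
      = \<theta>' * (\<integral>y. l (g x - g y) \<partial>?P) + (1 - \<theta>') * (\<integral>y. l (g x - g y) \<partial>?N)" for x
    by (rule integral_law_mixture[OF p q \<theta>(2), where C = K]) (use abs_le in auto)
  then have right: "?R A (law M (mixture \<theta>' p q))
      = (\<integral>x. \<theta>' * (\<integral>y. l (g x - g y) \<partial>?P) + (1 - \<theta>') * (\<integral>y. l (g x - g y) \<partial>?N) \<partial>A)" for A
    by (simp add: auc_risk_def)
  have "?R A (law M (mixture \<theta>' p q)) = \<theta>' * ?R A ?P + (1 - \<theta>') * ?R A ?N"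
    if A: "prob_space A" "sets A = sets M" for A
  proof -
    interpret prob_space A by fact
    have "integrable A (\<lambda>x. \<integral>y. l (g x - g y) \<partial>law M r)" if r: "prob_density M r" for r
    proof (rule integrable_const_bound[of _ K])
      show "(\<lambda>x. \<integral>y. l (g x - g y) \<partial>law M r) \<in> borel_measurable A"
        using outer(1)[OF r] unfolding measurable_cong_sets[OF A(2) refl] .
      show "AE x in A. norm (\<integral>y. l (g x - g y) \<partial>law M r) \<le> K"
        using outer(2)[OF r] sets_eq_imp_space_eq[OF A(2)] by (intro AE_I2) simp
    qed
    then show ?thesis
      using p q by (subst right) (simp add: auc_risk_def)
  qed
  note right' = this[OF prob_space_law sets_law]
  have left: "?R (law M (mixture \<theta> p q)) (law M r) = \<theta> * ?R ?P (law M r) + (1 - \<theta>) * ?R ?N (law M r)"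
    if "prob_density M r" for r
    unfolding auc_risk_def by (rule integral_law_mixture[OF p q \<theta>(1) outer[OF that]])
  have swap: "?R (law M r) (law M r') = K - ?R (law M r') (law M r)"
    if "prob_density M r" "prob_density M r'" for r r'
    by (rule auc_risk_swap[OF prob_space_law prob_space_law sets_law sets_law g l sym rng]) fact+
  have "?R (law M (mixture \<theta> p q)) (law M (mixture \<theta>' p q))
      = \<theta>' * (\<theta> * ?R ?P ?P + (1 - \<theta>) * ?R ?N ?P) + (1 - \<theta>') * (\<theta> * ?R ?P ?N + (1 - \<theta>) * ?R ?N ?N)"
    using right'[OF prob_density_mixture[OF p q \<theta>(1)]] left[OF p] left[OF q] by simp
  \<comment> \<open>With equal arguments the swap identity reads R = K - R.\<close>
  also have "?R ?P ?P = K / 2" using swap[OF p p] by linarith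
  also have "?R ?N ?N = K / 2" using swap[OF q q] by linarith
  also have "?R ?N ?P = K - ?R ?P ?N" by (rule swap[OF q p])
  finally show ?thesis by (simp add: field_simps)
qed

section \<open>Sign-selected samples\<close>

lemma nn_integral_pair_mult:
  fixes u :: "'a \<Rightarrow> ennreal" and v :: "'b \<Rightarrow> ennreal"
  assumes "sigma_finite_measure B"
    and [measurable]: "u \<in> borel_measurable A" "v \<in> borel_measurable B"
  shows "(\<integral>\<^sup>+z. u (fst z) * v (snd z) \<partial>(A \<Otimes>\<^sub>M B)) = (\<integral>\<^sup>+a. u a \<partial>A) * (\<integral>\<^sup>+b. v b \<partial>B)"
proof -
  interpret B: sigma_finite_measure B by fact
  have "(\<integral>\<^sup>+z. u (fst z) * v (snd z) \<partial>(A \<Otimes>\<^sub>M B)) = (\<integral>\<^sup>+a. (\<integral>\<^sup>+b. u a * v b \<partial>B) \<partial>A)"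
    by (subst B.nn_integral_fst[symmetric]) auto
  then show ?thesis
    by (simp add: nn_integral_cmult nn_integral_multc)
qed

text \<open>\<open>h\<close> acts on a sample paired with a ghost sample by applying
  \<open>f\<close> to the two first components and \<open>g\<close> to the two second ones. Product
  measures are determined by rectangles, and on a rectangle the integrand factors into a part for
  each kind of component.\<close>

lemma distr_pair_interchange:
  assumes "prob_space A" "prob_space B"
    and f[measurable]: "f \<in> A \<Otimes>\<^sub>M A \<rightarrow>\<^sub>M A" and distr_f: "distr (A \<Otimes>\<^sub>M A) A f = A"
    and g[measurable]: "g \<in> B \<Otimes>\<^sub>M B \<rightarrow>\<^sub>M B" and distr_g: "distr (B \<Otimes>\<^sub>M B) B g = B"
  defines "h \<equiv> \<lambda>z. (f (fst (fst z), fst (snd z)), g (snd (fst z), snd (snd z)))"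
  shows "distr ((A \<Otimes>\<^sub>M B) \<Otimes>\<^sub>M (A \<Otimes>\<^sub>M B)) (A \<Otimes>\<^sub>M B) h = A \<Otimes>\<^sub>M B"
proof (rule pair_measure_eqI[symmetric])
  interpret A: prob_space A by fact
  interpret B: prob_space B by fact
  interpret AA: pair_prob_space A A ..
  interpret BB: pair_prob_space B B ..
  interpret AB: pair_prob_space A B ..
  interpret ABAB: pair_prob_space "A \<Otimes>\<^sub>M B" "A \<Otimes>\<^sub>M B" ..
  show "sigma_finite_measure A" "sigma_finite_measure B" ..
  have h[measurable]: "h \<in> (A \<Otimes>\<^sub>M B) \<Otimes>\<^sub>M (A \<Otimes>\<^sub>M B) \<rightarrow>\<^sub>M A \<Otimes>\<^sub>M B"
    unfolding h_def by measurable
  show "sets (A \<Otimes>\<^sub>M B) = sets (distr ((A \<Otimes>\<^sub>M B) \<Otimes>\<^sub>M (A \<Otimes>\<^sub>M B)) (A \<Otimes>\<^sub>M B) h)"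
    by simp
  fix X Y assume [measurable]: "X \<in> sets A" "Y \<in> sets B"
  define u where "u z = (indicator X (f z) :: ennreal)" for z
  define v where "v z = (indicator Y (g z) :: ennreal)" for z
  have [measurable]: "u \<in> borel_measurable (A \<Otimes>\<^sub>M A)" "v \<in> borel_measurable (B \<Otimes>\<^sub>M B)"
    unfolding u_def v_def by measurable
  have "emeasure (distr ((A \<Otimes>\<^sub>M B) \<Otimes>\<^sub>M (A \<Otimes>\<^sub>M B)) (A \<Otimes>\<^sub>M B) h) (X \<times> Y)
      = (\<integral>\<^sup>+z. indicator (X \<times> Y) z \<partial>distr ((A \<Otimes>\<^sub>M B) \<Otimes>\<^sub>M (A \<Otimes>\<^sub>M B)) (A \<Otimes>\<^sub>M B) h)"
    by (subst nn_integral_indicator) simp_all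
  also have "\<dots> = (\<integral>\<^sup>+z. indicator (X \<times> Y) (h z) \<partial>((A \<Otimes>\<^sub>M B) \<Otimes>\<^sub>M (A \<Otimes>\<^sub>M B)))"
    by (rule nn_integral_distr) measurable
  also have "\<dots> = (\<integral>\<^sup>+z. u (fst (fst z), fst (snd z)) * v (snd (fst z), snd (snd z))
      \<partial>((A \<Otimes>\<^sub>M B) \<Otimes>\<^sub>M (A \<Otimes>\<^sub>M B)))"
    by (simp add: h_def u_def v_def indicator_times)
  \<comment> \<open>Fubini separates the two pairs; the product then factors in \<open>t\<close> for
    fixed \<open>s\<close>, and afterwards in \<open>s\<close>.\<close>
  also have "\<dots> = (\<integral>\<^sup>+s. (\<integral>\<^sup>+t. u (fst s, fst t) * v (snd s, snd t) \<partial>(A \<Otimes>\<^sub>M B)) \<partial>(A \<Otimes>\<^sub>M B))"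
    by (subst AB.nn_integral_fst[symmetric]) simp_all
  also have "\<dots> = (\<integral>\<^sup>+s. (\<integral>\<^sup>+a. u (fst s, a) \<partial>A) * (\<integral>\<^sup>+b. v (snd s, b) \<partial>B) \<partial>(A \<Otimes>\<^sub>M B))"
    by (intro nn_integral_cong nn_integral_pair_mult B.sigma_finite_measure_axioms)
      (auto simp: space_pair_measure)
  also have "\<dots> = (\<integral>\<^sup>+a. (\<integral>\<^sup>+a'. u (a, a') \<partial>A) \<partial>A) * (\<integral>\<^sup>+b. (\<integral>\<^sup>+b'. v (b, b') \<partial>B) \<partial>B)"
    by (intro nn_integral_pair_mult B.sigma_finite_measure_axioms) measurable
  also have "\<dots> = (\<integral>\<^sup>+z. u z \<partial>(A \<Otimes>\<^sub>M A)) * (\<integral>\<^sup>+z. v z \<partial>(B \<Otimes>\<^sub>M B))"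
    by (simp add: A.nn_integral_fst B.nn_integral_fst)
  also have "(\<integral>\<^sup>+z. u z \<partial>(A \<Otimes>\<^sub>M A)) = (\<integral>\<^sup>+a. indicator X a \<partial>distr (A \<Otimes>\<^sub>M A) A f)"
    unfolding u_def by (subst nn_integral_distr) simp_all
  also have "\<dots> = emeasure A X"
    by (simp add: distr_f)
  also have "(\<integral>\<^sup>+z. v z \<partial>(B \<Otimes>\<^sub>M B)) = (\<integral>\<^sup>+b. indicator Y b \<partial>distr (B \<Otimes>\<^sub>M B) B g)"
    unfolding v_def by (subst nn_integral_distr) simp_all
  also have "\<dots> = emeasure B Y"
    by (simp add: distr_g)
  finally show "emeasure A X * emeasure B Y
      = emeasure (distr ((A \<Otimes>\<^sub>M B) \<Otimes>\<^sub>M (A \<Otimes>\<^sub>M B)) (A \<Otimes>\<^sub>M B) h) (X \<times> Y)" ..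
qed

text \<open>Sign 1 takes the point of the second argument (the ghost sample). Restriction to the
  index range makes the result a point of the product space.\<close>

definition select :: "nat \<Rightarrow> (nat \<Rightarrow> real) \<Rightarrow> (nat \<Rightarrow> 'a) \<Rightarrow> (nat \<Rightarrow> 'a) \<Rightarrow> nat \<Rightarrow> 'a" where
  "select n \<sigma> x y = (\<lambda>i\<in>{..<n}. if \<sigma> i = 1 then y i else x i)"

lemma measurable_select [measurable]:
  "(\<lambda>(x, y). select n \<sigma> x y) \<in> (\<Pi>\<^sub>M i\<in>{..<n}. \<mu>) \<Otimes>\<^sub>M (\<Pi>\<^sub>M i\<in>{..<n}. \<mu>) \<rightarrow>\<^sub>M (\<Pi>\<^sub>M i\<in>{..<n}. \<mu>)"
  unfolding select_def split_beta
proof (rule measurable_restrict)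
  fix i assume i: "i \<in> {..<n}"
  have "(\<lambda>x. x i) \<in> (\<Pi>\<^sub>M i\<in>{..<n}. \<mu>) \<rightarrow>\<^sub>M \<mu>"
    using i by (rule measurable_component_singleton)
  from measurable_compose[OF measurable_fst this] measurable_compose[OF measurable_snd this]
  show "(\<lambda>z. if \<sigma> i = 1 then snd z i else fst z i)
      \<in> (\<Pi>\<^sub>M i\<in>{..<n}. \<mu>) \<Otimes>\<^sub>M (\<Pi>\<^sub>M i\<in>{..<n}. \<mu>) \<rightarrow>\<^sub>M \<mu>"
    by (cases "\<sigma> i = 1") simp_all
qed

text \<open>For fixed signs each index uses exactly one of two independent copies, so the selected
  points are again i.i.d.\<close>

lemma distr_select:
  fixes n :: nat
  assumes \<mu>: "prob_space \<mu>"
  defines "P \<equiv> \<Pi>\<^sub>M i\<in>{..<n}. \<mu>"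
  shows "distr (P \<Otimes>\<^sub>M P) P (\<lambda>(x, y). select n \<sigma> x y) = P"
proof -
  interpret prob_space \<mu> by fact
  interpret product_sigma_finite "\<lambda>_ :: nat. \<mu>" ..
  interpret P: prob_space P unfolding P_def by (rule prob_space_PiM, rule \<mu>)
  let ?f = "\<lambda>(x, y). select n \<sigma> x y"
  have f[measurable]: "?f \<in> P \<Otimes>\<^sub>M P \<rightarrow>\<^sub>M P"
    unfolding P_def by (rule measurable_select)
  show ?thesis
    unfolding P_def
  proof (rule PiM_eqI, fold P_def)
    fix A assume A: "\<And>i. i \<in> {..<n} \<Longrightarrow> A i \<in> sets \<mu>"
    \<comment> \<open>The preimage of the box \<open>A\<close> is a product of two boxes: at each
      index one copy is constrained to \<open>A i\<close> and the other is free, contributing a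
      factor 1.\<close>
    define X where "X i = (if \<sigma> i = 1 then space \<mu> else A i)" for i
    define Y where "Y i = (if \<sigma> i = 1 then A i else space \<mu>)" for i
    have XY: "X i \<in> sets \<mu>" "Y i \<in> sets \<mu>" if "i \<in> {..<n}" for i
      using A[OF that] by (auto simp: X_def Y_def)
    have boxes: "Pi\<^sub>E {..<n} A \<in> sets P" "Pi\<^sub>E {..<n} X \<in> sets P" "Pi\<^sub>E {..<n} Y \<in> sets P"
      unfolding P_def using A XY by (auto intro!: sets_PiM_I_finite)
    have "A i \<subseteq> space \<mu>" if "i < n" for i
      using A that sets.sets_into_space by auto
    then have eq: "?f -` (Pi\<^sub>E {..<n} A) \<inter> space (P \<Otimes>\<^sub>M P) = Pi\<^sub>E {..<n} X \<times> Pi\<^sub>E {..<n} Y"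
      by (auto simp: P_def space_pair_measure space_PiM select_def X_def Y_def PiE_iff
          split: if_splits) (metis lessThan_iff subsetD)+
    have "emeasure (distr (P \<Otimes>\<^sub>M P) P ?f) (Pi\<^sub>E {..<n} A)
        = emeasure P (Pi\<^sub>E {..<n} X) * emeasure P (Pi\<^sub>E {..<n} Y)"
      using boxes by (simp add: emeasure_distr[OF f] eq P.emeasure_pair_measure_Times)
    also have "\<dots> = (\<Prod>i<n. emeasure \<mu> (X i) * emeasure \<mu> (Y i))"
      unfolding P_def prod.distrib using XY
      by (intro arg_cong2[of _ _ _ _ "(*)"] emeasure_PiM) auto
    also have "\<dots> = (\<Prod>i<n. emeasure \<mu> (A i))"
      by (intro prod.cong) (auto simp: X_def Y_def emeasure_space_1)
    finally show "emeasure (distr (P \<Otimes>\<^sub>M P) P ?f) (Pi\<^sub>E {..<n} A) = (\<Prod>i<n. emeasure \<mu> (A i))" .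
  qed (simp_all add: P_def)
qed

definition select_samples ::
    "nat \<Rightarrow> nat \<Rightarrow> (nat \<Rightarrow> real) \<Rightarrow> (nat \<Rightarrow> real) \<Rightarrow>
     ((nat \<Rightarrow> 'a) \<times> (nat \<Rightarrow> 'a)) \<times> ((nat \<Rightarrow> 'a) \<times> (nat \<Rightarrow> 'a)) \<Rightarrow> (nat \<Rightarrow> 'a) \<times> (nat \<Rightarrow> 'a)" where
  "select_samples n m \<sigma> \<upsilon> z =
     (select n \<sigma> (fst (fst z)) (fst (snd z)), select m \<upsilon> (snd (fst z)) (snd (snd z)))"

lemma distr_select_samples:
  assumes \<mu>: "prob_space \<mu>" and \<nu>: "prob_space \<nu>"
  shows "distr (two_samples n m \<mu> \<nu> \<Otimes>\<^sub>M two_samples n m \<mu> \<nu>) (two_samples n m \<mu> \<nu>)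
    (select_samples n m \<sigma> \<upsilon>) = two_samples n m \<mu> \<nu>"
proof -
  have "prob_space (\<Pi>\<^sub>M i\<in>{..<n}. \<mu>)" "prob_space (\<Pi>\<^sub>M j\<in>{..<m}. \<nu>)"
    by (rule prob_space_PiM, rule \<mu>, rule prob_space_PiM, rule \<nu>)
  from distr_pair_interchange[OF this measurable_select[of n \<sigma>] distr_select[OF \<mu>]
      measurable_select[of m \<upsilon>] distr_select[OF \<nu>]]
  show ?thesis
    by (simp add: two_samples_def select_samples_def[abs_def])
qed

lemma measurable_select_samples [measurable]:
  "select_samples n m \<sigma> \<upsilon>
    \<in> two_samples n m \<mu> \<nu> \<Otimes>\<^sub>M two_samples n m \<mu> \<nu> \<rightarrow>\<^sub>M two_samples n m \<mu> \<nu>"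
proof -
  have "(\<lambda>z. select n \<sigma> (f z) (g z)) \<in> N \<rightarrow>\<^sub>M (\<Pi>\<^sub>M i\<in>{..<n}. \<mu>)"
    if "f \<in> N \<rightarrow>\<^sub>M (\<Pi>\<^sub>M i\<in>{..<n}. \<mu>)" "g \<in> N \<rightarrow>\<^sub>M (\<Pi>\<^sub>M i\<in>{..<n}. \<mu>)"
    for n \<sigma> f g and N :: "'b measure" and \<mu> :: "'c measure"
    using measurable_compose[OF measurable_Pair[OF that] measurable_select] by simp
  then show ?thesis
    unfolding select_samples_def[abs_def] two_samples_def by (intro measurable_Pair) measurable
qed

section \<open>Expectations over random signs\<close>

lemma finite_set_rademacher_signs [simp]: "finite (set_pmf (rademacher_signs n))"
  unfolding rademacher_signs_def by (simp add: set_Pi_pmf finite_PiE_dflt)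

lemma rademacher_signs_values:
  assumes "\<sigma> \<in> set_pmf (rademacher_signs n)" "i < n"
  shows "\<sigma> i \<in> {-1, 1}"
  using assms unfolding rademacher_signs_def by (auto simp: set_Pi_pmf PiE_dflt_def)

text \<open>Only one sign from each family enters, and these two are jointly uniform on the four
  sign patterns.\<close>

lemma expectation_rademacher_pair:
  fixes \<phi> :: "real \<Rightarrow> real \<Rightarrow> real"
  assumes "i < n" "j < m"
  shows "measure_pmf.expectation (pair_pmf (rademacher_signs n) (rademacher_signs m))
      (\<lambda>(\<sigma>, \<upsilon>). \<phi> (\<sigma> i) (\<upsilon> j)) = (\<phi> 1 1 + \<phi> 1 (-1) + \<phi> (-1) 1 + \<phi> (-1) (-1)) / 4"
proof -
  let ?S = "pmf_of_set {-1, 1 :: real}"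
  have "map_pmf (\<lambda>(\<sigma>, \<upsilon>). (\<sigma> i, \<upsilon> j)) (pair_pmf (rademacher_signs n) (rademacher_signs m))
      = pair_pmf ?S ?S"
    unfolding map_pair rademacher_signs_def using assms by (simp add: Pi_pmf_component)
  then have "measure_pmf.expectation (pair_pmf (rademacher_signs n) (rademacher_signs m))
      (\<lambda>(\<sigma>, \<upsilon>). \<phi> (\<sigma> i) (\<upsilon> j)) = measure_pmf.expectation (pair_pmf ?S ?S) (\<lambda>(a, b). \<phi> a b)"
    by (metis (mono_tags, lifting) integral_map_pmf case_prod_beta' fst_conv snd_conv
        Bochner_Integration.integral_cong)
  also have "\<dots> = (\<Sum>z\<in>{(1, 1), (1, -1), (-1, 1), (-1, -1)}.
      pmf (pair_pmf ?S ?S) z *\<^sub>R (case z of (a, b) \<Rightarrow> \<phi> a b))"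
    by (rule integral_measure_pmf) auto
  also have "\<dots> = (\<phi> 1 1 + \<phi> 1 (-1) + \<phi> (-1) 1 + \<phi> (-1) (-1)) / 4"
    by (simp add: pmf_pair add_divide_distrib)
  finally show ?thesis .
qed

section \<open>Bipartite symmetrization\<close>

text \<open>The supremum is 1-Lipschitz for the uniform distance. This carries bounds and bounded
  differences from single functions over to suprema over the class.\<close>

lemma cSUP_diff_abs_le:
  fixes f g :: "'a \<Rightarrow> real"
  assumes "A \<noteq> {}" "bdd_above (f ` A)" "bdd_above (g ` A)" "\<And>x. x \<in> A \<Longrightarrow> \<bar>f x - g x\<bar> \<le> c"
  shows "\<bar>(SUP x\<in>A. f x) - (SUP x\<in>A. g x)\<bar> \<le> c"
proof -
  have "(SUP x\<in>A. f x) \<le> (SUP x\<in>A. g x) + c" if "bdd_above (g ` A)"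
    "\<And>x. x \<in> A \<Longrightarrow> \<bar>f x - g x\<bar> \<le> c" for f g :: "'a \<Rightarrow> real"
  proof (rule cSUP_least[OF \<open>A \<noteq> {}\<close>])
    fix x assume "x \<in> A"
    then show "f x \<le> (SUP x\<in>A. g x) + c"
      using cSUP_upper[OF \<open>x \<in> A\<close> that(1)] that(2)[OF \<open>x \<in> A\<close>] by linarith
  qed
  from this[of g f] this[of f g] show ?thesis
    using assms by (simp add: abs_minus_commute abs_le_iff)
qed

text \<open>Symmetrization and concentration see the loss only through its class of functions on
  pairs. The range and nonemptiness keep the suprema finite and meaningful; positive
  \<open>n\<close> and \<open>m\<close> make the double sums true averages.\<close>

locale bipartite_class =
  fixes n m :: nat and \<mu> \<nu> :: "'a measure" and \<Q> :: "('a \<times> 'a \<Rightarrow> real) set" and K :: real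
  assumes \<mu>: "prob_space \<mu>" and \<nu>: "prob_space \<nu>"
    and n_pos: "n > 0" and m_pos: "m > 0"
    and nonempty: "\<Q> \<noteq> {}"
    and range: "\<And>q z. q \<in> \<Q> \<Longrightarrow> q z \<in> {0..K}"
    and measurable_class: "\<And>q. q \<in> \<Q> \<Longrightarrow> q \<in> borel_measurable (\<mu> \<Otimes>\<^sub>M \<nu>)"
    and well_defined: "bipartite_rademacher_well_defined n m \<mu> \<nu> \<Q>"
begin

abbreviation "S \<equiv> two_samples n m \<mu> \<nu>"
abbreviation "signs \<equiv> pair_pmf (rademacher_signs n) (rademacher_signs m)"

definition emp :: "('a \<times> 'a \<Rightarrow> real) \<Rightarrow> (nat \<Rightarrow> 'a) \<times> (nat \<Rightarrow> 'a) \<Rightarrow> real" where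
  "emp q s = 1 / (real n * real m) * (\<Sum>i<n. \<Sum>j<m. q (fst s i, snd s j))"

text \<open>
  Here \<open>z = (s, t)\<close> is the sample paired with a ghost sample, and each sign decides which of the two
  provides the corresponding point. For a single \<open>q\<close> in place of the supremum, averaging over the
  signs kills the mixed pairs (coefficient \<open>0\<close>) and leaves exactly \<open>emp q t - emp q s\<close>; for fixed
  signs the selected points are again i.i.d. samples.
\<close>

definition ghost_bound ::
    "((nat \<Rightarrow> 'a) \<times> (nat \<Rightarrow> 'a)) \<times> ((nat \<Rightarrow> 'a) \<times> (nat \<Rightarrow> 'a)) \<Rightarrow> real" where
  "ghost_bound z = 4 * measure_pmf.expectation signs
     (\<lambda>(\<sigma>, \<upsilon>). bipartite_sup n m \<Q> \<sigma> \<upsilon> (select_samples n m \<sigma> \<upsilon> z))"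

text \<open>Averaging over the ghost sample \<open>t\<close> turns \<open>emp q t\<close> into its
  expectation, so this dominates the deviation of every \<open>q\<close> at once.\<close>

definition deviation_bound :: "(nat \<Rightarrow> 'a) \<times> (nat \<Rightarrow> 'a) \<Rightarrow> real" where
  "deviation_bound s = (\<integral>t. ghost_bound (s, t) \<partial>S)"

text \<open>The fraction of index pairs whose points differ: a Hamming-type distance in which all
  bounded differences are expressed.\<close>

definition disagreement :: "(nat \<Rightarrow> 'a) \<times> (nat \<Rightarrow> 'a) \<Rightarrow> (nat \<Rightarrow> 'a) \<times> (nat \<Rightarrow> 'a) \<Rightarrow> real" where
  "disagreement s s' = 1 / (real n * real m) *
     (\<Sum>i<n. \<Sum>j<m. of_bool (fst s i \<noteq> fst s' i \<or> snd s j \<noteq> snd s' j))"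

section \<open>Signed averages and their suprema\<close>

lemma prob_space_S: "prob_space S"
proof -
  interpret P: prob_space "\<Pi>\<^sub>M i\<in>{..<n}. \<mu>" by (rule prob_space_PiM, rule \<mu>)
  interpret Q: prob_space "\<Pi>\<^sub>M i\<in>{..<m}. \<nu>" by (rule prob_space_PiM, rule \<nu>)
  interpret PQ: pair_prob_space "\<Pi>\<^sub>M i\<in>{..<n}. \<mu>" "\<Pi>\<^sub>M i\<in>{..<m}. \<nu>" ..
  show ?thesis unfolding two_samples_def by (rule PQ.prob_space_axioms)
qed

sublocale S: prob_space S by (rule prob_space_S)

sublocale SS: pair_prob_space S S ..

lemma K_nonneg: "K \<ge> 0"
  using nonempty range by (metis atLeastAtMost_iff ex_in_conv order_trans)

lemma double_mean_abs_le:
  fixes f g :: "nat \<Rightarrow> nat \<Rightarrow> real"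
  assumes "\<And>i j. i < n \<Longrightarrow> j < m \<Longrightarrow> \<bar>f i j\<bar> \<le> g i j"
  shows "\<bar>1 / (real n * real m) * (\<Sum>i<n. \<Sum>j<m. f i j)\<bar>
    \<le> 1 / (real n * real m) * (\<Sum>i<n. \<Sum>j<m. g i j)"
proof -
  have "\<bar>\<Sum>i<n. \<Sum>j<m. f i j\<bar> \<le> (\<Sum>i<n. \<Sum>j<m. \<bar>f i j\<bar>)"
    by (rule order_trans[OF sum_abs]) (intro sum_mono sum_abs)
  also have "\<dots> \<le> (\<Sum>i<n. \<Sum>j<m. g i j)"
    using assms by (intro sum_mono) auto
  finally show ?thesis by (simp add: abs_mult divide_right_mono)
qed

lemma double_mean_const: "1 / (real n * real m) * (\<Sum>i<n. \<Sum>j<m. c) = c"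
  using n_pos m_pos by simp

lemma signs_values:
  assumes "(\<sigma>, \<upsilon>) \<in> set_pmf signs"
  shows "i < n \<Longrightarrow> \<sigma> i = -1 \<or> \<sigma> i = 1" "j < m \<Longrightarrow> \<upsilon> j = -1 \<or> \<upsilon> j = 1"
  using assms rademacher_signs_values[of \<sigma> n i] rademacher_signs_values[of \<upsilon> m j] by auto

lemma integrable_signs [simp]: "integrable (measure_pmf signs) (f :: _ \<Rightarrow> real)"
  by (rule integrable_measure_pmf_finite) simp

lemma expectation_signs_le:
  fixes f g :: "(nat \<Rightarrow> real) \<times> (nat \<Rightarrow> real) \<Rightarrow> real"
  assumes "\<And>\<sigma> \<upsilon>. (\<sigma>, \<upsilon>) \<in> set_pmf signs \<Longrightarrow> f (\<sigma>, \<upsilon>) \<le> g (\<sigma>, \<upsilon>)"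
  shows "measure_pmf.expectation signs f \<le> measure_pmf.expectation signs g"
  using assms by (intro integral_mono_AE) (auto simp: AE_measure_pmf_iff simp del: set_pair_pmf)

lemma expectation_signs_double_mean:
  fixes \<phi> :: "nat \<Rightarrow> nat \<Rightarrow> real \<Rightarrow> real \<Rightarrow> real"
  shows "measure_pmf.expectation signs
      (\<lambda>(\<sigma>, \<upsilon>). 1 / (real n * real m) * (\<Sum>i<n. \<Sum>j<m. \<phi> i j (\<sigma> i) (\<upsilon> j)))
    = 1 / (real n * real m) * (\<Sum>i<n. \<Sum>j<m.
        (\<phi> i j 1 1 + \<phi> i j 1 (-1) + \<phi> i j (-1) 1 + \<phi> i j (-1) (-1)) / 4)"
proof -
  have "measure_pmf.expectation signs
      (\<lambda>(\<sigma>, \<upsilon>). 1 / (real n * real m) * (\<Sum>i<n. \<Sum>j<m. \<phi> i j (\<sigma> i) (\<upsilon> j)))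
    = 1 / (real n * real m) * (\<Sum>i<n. \<Sum>j<m.
        measure_pmf.expectation signs (\<lambda>(\<sigma>, \<upsilon>). \<phi> i j (\<sigma> i) (\<upsilon> j)))"
    unfolding split_beta by (simp del: integral_divide_zero)
  then show ?thesis
    by (simp add: expectation_rademacher_pair)
qed

abbreviation signed :: "('a \<times> 'a \<Rightarrow> real) \<Rightarrow> (nat \<Rightarrow> real) \<Rightarrow> (nat \<Rightarrow> real) \<Rightarrow>
    (nat \<Rightarrow> 'a) \<times> (nat \<Rightarrow> 'a) \<Rightarrow> real" where
  "signed q \<sigma> \<upsilon> s \<equiv>
     1 / (real n * real m) * (\<Sum>i<n. \<Sum>j<m. (\<sigma> i + \<upsilon> j) / 2 * q (fst s i, snd s j))"

text \<open>For signs in the support each weight is -1, 0 or 1.\<close>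

lemma signed_abs_le:
  assumes "q \<in> \<Q>" "(\<sigma>, \<upsilon>) \<in> set_pmf signs"
  shows "\<bar>signed q \<sigma> \<upsilon> s\<bar> \<le> K"
proof -
  have "\<bar>(\<sigma> i + \<upsilon> j) / 2 * q (fst s i, snd s j)\<bar> \<le> K" if "i < n" "j < m" for i j
    using signs_values(1)[OF assms(2), of i] signs_values(2)[OF assms(2), of j] that
        range[OF assms(1), of "(fst s i, snd s j)"]
    by auto
  from double_mean_abs_le[of "\<lambda>i j. (\<sigma> i + \<upsilon> j) / 2 * q (fst s i, snd s j)" "\<lambda>_ _. K", OF this]
  show ?thesis unfolding double_mean_const .
qed

lemma bdd_above_signed:
  assumes "(\<sigma>, \<upsilon>) \<in> set_pmf signs"
  shows "bdd_above ((\<lambda>q. signed q \<sigma> \<upsilon> s) ` \<Q>)"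
  by (rule bdd_aboveI2) (rule abs_le_D1[OF signed_abs_le[OF _ assms]])

lemma signed_le_sup:
  assumes "q \<in> \<Q>" "(\<sigma>, \<upsilon>) \<in> set_pmf signs"
  shows "signed q \<sigma> \<upsilon> s \<le> bipartite_sup n m \<Q> \<sigma> \<upsilon> s"
  unfolding bipartite_sup_def by (rule cSUP_upper[OF assms(1) bdd_above_signed[OF assms(2)]])

lemma bipartite_sup_abs_le:
  assumes "(\<sigma>, \<upsilon>) \<in> set_pmf signs"
  shows "\<bar>bipartite_sup n m \<Q> \<sigma> \<upsilon> s\<bar> \<le> K"
proof -
  \<comment> \<open>Comparing with the zero family, whose supremum over the nonempty class is 0,
    bounds the supremum on both sides.\<close>
  have "\<bar>(SUP q\<in>\<Q>. signed q \<sigma> \<upsilon> s) - (SUP q\<in>\<Q>. 0)\<bar> \<le> K"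
    using signed_abs_le[OF _ assms] by (intro cSUP_diff_abs_le nonempty bdd_above_signed assms) auto
  then show ?thesis
    using nonempty by (simp add: bipartite_sup_def)
qed

lemma measurable_bipartite_sup [measurable]:
  assumes "(\<sigma>, \<upsilon>) \<in> set_pmf signs"
  shows "bipartite_sup n m \<Q> \<sigma> \<upsilon> \<in> borel_measurable S"
proof -
  have "\<sigma> \<in> {..<n} \<rightarrow> {-1, 1}" "\<upsilon> \<in> {..<m} \<rightarrow> {-1, 1}"
    using signs_values[OF assms] by auto
  then show ?thesis
    using well_defined unfolding bipartite_rademacher_well_defined_def by blast
qed

text \<open>As a finite sum, the sign expectation preserves measurability and commutes with the
  integral over the samples.\<close>

lemma expectation_signs_sum:
  "measure_pmf.expectation signs f = (\<Sum>a\<in>set_pmf signs. pmf signs a * f a)"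
  by (subst integral_measure_pmf[of "set_pmf signs"]) simp_all

section \<open>Domination and stability of the ghost bound\<close>

lemma emp_diff_le_ghost_bound:
  assumes "q \<in> \<Q>"
  shows "emp q t - emp q s \<le> ghost_bound (s, t)"
proof -
  \<comment> \<open>The summand as a function of its two signs: signs (1, 1) give \<open>q\<close>
    at the ghost points, (-1, -1) give minus \<open>q\<close> at the sample points, and mixed signs
    give 0. The factor 4 below undoes the probability 1 / 4 of each pattern.\<close>
  define \<phi> where "\<phi> i j a b = (a + b) / 2 *
    q (if a = 1 then fst t i else fst s i, if b = 1 then snd t j else snd s j)"
    for i j and a b :: real
  have "emp q t - emp q s = 4 * (1 / (real n * real m) * (\<Sum>i<n. \<Sum>j<m.
        (\<phi> i j 1 1 + \<phi> i j 1 (-1) + \<phi> i j (-1) 1 + \<phi> i j (-1) (-1)) / 4))"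
    by (simp add: emp_def \<phi>_def sum_subtractf right_diff_distrib diff_divide_distrib
        flip: sum_divide_distrib)
  also have "\<dots> = 4 * measure_pmf.expectation signs
      (\<lambda>(\<sigma>, \<upsilon>). signed q \<sigma> \<upsilon> (select_samples n m \<sigma> \<upsilon> (s, t)))"
    unfolding expectation_signs_double_mean[symmetric]
    by (simp add: \<phi>_def select_samples_def select_def)
  also have "\<dots> \<le> ghost_bound (s, t)"
    unfolding ghost_bound_def
    by (intro mult_left_mono expectation_signs_le) (use signed_le_sup[OF assms] in auto)
  finally show ?thesis .
qed

lemma ghost_bound_abs_le: "\<bar>ghost_bound z\<bar> \<le> 4 * K"
proof -
  let ?U = "\<lambda>(\<sigma>, \<upsilon>). bipartite_sup n m \<Q> \<sigma> \<upsilon> (select_samples n m \<sigma> \<upsilon> z)"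
  have "\<bar>measure_pmf.expectation signs ?U\<bar> \<le> measure_pmf.expectation signs (\<lambda>a. \<bar>?U a\<bar>)"
    by (rule integral_abs_bound)
  also have "\<dots> \<le> measure_pmf.expectation signs (\<lambda>_. K)"
    by (rule expectation_signs_le) (use bipartite_sup_abs_le in simp)
  finally show ?thesis by (simp add: ghost_bound_def abs_mult)
qed

lemma measurable_ghost_bound [measurable]: "ghost_bound \<in> borel_measurable (S \<Otimes>\<^sub>M S)"
  unfolding ghost_bound_def[abs_def] expectation_signs_sum
proof (intro borel_measurable_times borel_measurable_const borel_measurable_sum)
  fix a assume "a \<in> set_pmf signs"
  then show "(\<lambda>z. case a of (\<sigma>, \<upsilon>) \<Rightarrow> bipartite_sup n m \<Q> \<sigma> \<upsilon> (select_samples n m \<sigma> \<upsilon> z))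
      \<in> borel_measurable (S \<Otimes>\<^sub>M S)"
    by (cases a) (auto intro: measurable_compose[OF measurable_select_samples measurable_bipartite_sup])
qed

text \<open>
  A point of \<open>s\<close> enters with nonzero weight only when both signs of the pair are \<open>-1\<close>, which has
  probability \<open>1 / 4\<close>; this cancels the factor \<open>4\<close>, so that \<open>ghost_bound\<close> is as stable in \<open>s\<close> as
  the empirical mean of a single function.
\<close>

lemma ghost_bound_diff_le: "\<bar>ghost_bound (s, t) - ghost_bound (s', t)\<bar> \<le> K * disagreement s s'"
proof -
  define D where "D i j = (of_bool (fst s i \<noteq> fst s' i \<or> snd s j \<noteq> snd s' j) :: real)" for i j
  \<comment> \<open>A bound for the change of one summand when \<open>s\<close> becomes
    \<open>s'\<close>: mixed signs carry weight 0, and two positive signs read \<open>t\<close>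
    alone. With both signs negative, two values in [0, K] are compared, which agree unless a point
    of the pair changed.\<close>
  define \<phi> where "\<phi> i j a b = K * D i j * of_bool (a = -1 \<and> b = -1)" for i j and a b :: real
  let ?U = "\<lambda>s (\<sigma>, \<upsilon>). bipartite_sup n m \<Q> \<sigma> \<upsilon> (select_samples n m \<sigma> \<upsilon> (s, t))"
  let ?E = "measure_pmf.expectation signs"
  have sup_diff: "\<bar>bipartite_sup n m \<Q> \<sigma> \<upsilon> (select_samples n m \<sigma> \<upsilon> (s, t))
      - bipartite_sup n m \<Q> \<sigma> \<upsilon> (select_samples n m \<sigma> \<upsilon> (s', t))\<bar>
      \<le> 1 / (real n * real m) * (\<Sum>i<n. \<Sum>j<m. \<phi> i j (\<sigma> i) (\<upsilon> j))"
    if sg: "(\<sigma>, \<upsilon>) \<in> set_pmf signs" for \<sigma> \<upsilon>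
    unfolding bipartite_sup_def
  proof (rule cSUP_diff_abs_le[OF nonempty bdd_above_signed[OF sg] bdd_above_signed[OF sg]])
    fix q assume q: "q \<in> \<Q>"
    let ?p = "\<lambda>s i j. (\<sigma> i + \<upsilon> j) / 2 *
      q (fst (select_samples n m \<sigma> \<upsilon> (s, t)) i, snd (select_samples n m \<sigma> \<upsilon> (s, t)) j)"
    have "\<bar>?p s i j - ?p s' i j\<bar> \<le> \<phi> i j (\<sigma> i) (\<upsilon> j)" if "i < n" "j < m" for i j
      using signs_values(1)[OF sg, of i] signs_values(2)[OF sg, of j] that
        K_nonneg range[OF q, of "(fst s i, snd s j)"]
        range[OF q, of "(fst s' i, snd s' j)"]
      by (auto simp: \<phi>_def D_def select_samples_def select_def abs_le_iff)
    from double_mean_abs_le[OF this]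
    show "\<bar>signed q \<sigma> \<upsilon> (select_samples n m \<sigma> \<upsilon> (s, t))
        - signed q \<sigma> \<upsilon> (select_samples n m \<sigma> \<upsilon> (s', t))\<bar>
        \<le> 1 / (real n * real m) * (\<Sum>i<n. \<Sum>j<m. \<phi> i j (\<sigma> i) (\<upsilon> j))"
      by (simp add: sum_subtractf right_diff_distrib diff_divide_distrib)
  qed
  have "\<bar>?E (?U s) - ?E (?U s')\<bar> = \<bar>?E (\<lambda>a. ?U s a - ?U s' a)\<bar>"
    unfolding Bochner_Integration.integral_diff[OF integrable_signs integrable_signs] ..
  also have "\<dots> \<le> ?E (\<lambda>a. \<bar>?U s a - ?U s' a\<bar>)"
    by (rule integral_abs_bound)
  also have "\<dots> \<le> ?E (\<lambda>(\<sigma>, \<upsilon>). 1 / (real n * real m) * (\<Sum>i<n. \<Sum>j<m. \<phi> i j (\<sigma> i) (\<upsilon> j)))"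
    by (rule expectation_signs_le) (use sup_diff in simp)
  \<comment> \<open>Only one of the four sign patterns contributes.\<close>
  also have "\<dots> = 1 / (real n * real m) * (\<Sum>i<n. \<Sum>j<m. K * D i j / 4)"
    unfolding expectation_signs_double_mean by (simp add: \<phi>_def)
  also have "\<dots> = K * disagreement s s' / 4"
    unfolding disagreement_def D_def[symmetric]
    by (simp add: sum_distrib_left sum_divide_distrib)
  finally show ?thesis
    unfolding ghost_bound_def by linarith
qed

lemma emp_diff_le:
  assumes "q \<in> \<Q>"
  shows "\<bar>emp q s - emp q s'\<bar> \<le> K * disagreement s s'"
proof -
  have "\<bar>q (fst s i, snd s j) - q (fst s' i, snd s' j)\<bar>
      \<le> K * of_bool (fst s i \<noteq> fst s' i \<or> snd s j \<noteq> snd s' j)" for i j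
    using range[OF assms, of "(fst s i, snd s j)"] range[OF assms, of "(fst s' i, snd s' j)"]
    by auto
  from double_mean_abs_le[OF this] show ?thesis
    by (simp add: emp_def disagreement_def sum_subtractf right_diff_distrib diff_divide_distrib
        flip: sum_distrib_left)
qed

text \<open>Changing one point of the first sample affects at most the \<open>m\<close> pairs in its
  row, out of n m.\<close>

lemma disagreement_upd_fst:
  assumes "i < n"
  shows "disagreement (x(i := y), x') (x, x') \<le> 1 / real n"
proof -
  have "(\<Sum>k<n. \<Sum>j<m. of_bool (fst (x(i := y), x') k \<noteq> fst (x, x') k \<or> snd (x(i := y), x') j \<noteq> snd (x, x') j))
      \<le> (\<Sum>k<n. if k = i then real m else 0)"
    by (intro sum_mono order_trans[OF sum_bounded_above[where K = "if _ = i then 1 else 0"]]) auto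
  also have "\<dots> = real m" using assms by simp
  finally show ?thesis
    using n_pos m_pos by (simp add: disagreement_def field_simps)
qed

text \<open>At most the \<open>n\<close> pairs in one column are affected.\<close>

lemma disagreement_upd_snd:
  assumes "j < m"
  shows "disagreement (x, x'(j := y)) (x, x') \<le> 1 / real m"
proof -
  have "(\<Sum>i<n. \<Sum>k<m. of_bool (fst (x, x'(j := y)) i \<noteq> fst (x, x') i \<or> snd (x, x'(j := y)) k \<noteq> snd (x, x') k))
      \<le> (\<Sum>i<n. \<Sum>k<m. if k = j then 1 else (0 :: real))"
    by (intro sum_mono) auto
  also have "\<dots> = real n" using assms by simp
  finally show ?thesis
    using n_pos m_pos by (simp add: disagreement_def field_simps)
qed

section \<open>The empirical mean of a single function\<close>

lemma emp_abs_le: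
  assumes "q \<in> \<Q>"
  shows "\<bar>emp q s\<bar> \<le> K"
proof -
  have "\<bar>q (fst s i, snd s j)\<bar> \<le> K" for i j
    using range[OF assms, of "(fst s i, snd s j)"] by auto
  from double_mean_abs_le[of "\<lambda>i j. q (fst s i, snd s j)" "\<lambda>_ _. K", OF this]
  show ?thesis unfolding double_mean_const emp_def .
qed

lemma measurable_pick:
  assumes "i < n" "j < m"
  shows "(\<lambda>s. (fst s i, snd s j)) \<in> S \<rightarrow>\<^sub>M \<mu> \<Otimes>\<^sub>M \<nu>"
  unfolding two_samples_def
  using assms by (intro measurable_Pair measurable_compose[OF measurable_fst]
      measurable_compose[OF measurable_snd] measurable_component_singleton) auto

lemma measurable_emp [measurable]:
  assumes "q \<in> \<Q>"
  shows "emp q \<in> borel_measurable S"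
  unfolding emp_def[abs_def]
  by (intro borel_measurable_times borel_measurable_const borel_measurable_sum
      measurable_compose[OF measurable_pick measurable_class[OF assms]]) auto

lemma integrable_emp [simp]: "q \<in> \<Q> \<Longrightarrow> integrable S (emp q)"
  by (rule S.integrable_const_bound[of _ K]) (use emp_abs_le in auto)

text \<open>The summands are dependent, but each pair of points has the product law of \<mu> and
  \<nu>, so all of them share one expectation and linearity suffices.\<close>

lemma expectation_emp:
  assumes q: "q \<in> \<Q>"
  shows "S.expectation (emp q) = (\<integral>x. (\<integral>y. q (x, y) \<partial>\<nu>) \<partial>\<mu>)"
proof -
  let ?P = "\<Pi>\<^sub>M i\<in>{..<n}. \<mu>" and ?Q = "\<Pi>\<^sub>M j\<in>{..<m}. \<nu>"
  interpret P: prob_space ?P by (rule prob_space_PiM, rule \<mu>)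
  interpret Q: prob_space ?Q by (rule prob_space_PiM, rule \<nu>)
  interpret PQ: pair_prob_space ?P ?Q ..
  interpret \<nu>: prob_space \<nu> by (rule \<nu>)
  note [measurable] = measurable_class[OF q]
  have meas: "(\<lambda>s. q (fst s i, snd s j)) \<in> borel_measurable S" if "i < n" "j < m" for i j
    by (rule measurable_compose[OF measurable_pick[OF that] measurable_class[OF q]])
  have bound: "\<bar>q z\<bar> \<le> K" for z
    using range[OF q, of z] by auto
  have int: "integrable S (\<lambda>s. q (fst s i, snd s j))" if "i < n" "j < m" for i j
    by (rule S.integrable_const_bound[of _ K]) (use meas[OF that] bound in auto)
  have "(\<integral>s. q (fst s i, snd s j) \<partial>S) = (\<integral>x. (\<integral>y. q (x, y) \<partial>\<nu>) \<partial>\<mu>)" if ij: "i < n" "j < m" for i j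
  proof -
    have comp_P: "(\<lambda>x. x i) \<in> ?P \<rightarrow>\<^sub>M \<mu>" and comp_Q: "(\<lambda>x. x j) \<in> ?Q \<rightarrow>\<^sub>M \<nu>"
      using ij by (auto intro: measurable_component_singleton)
    have distr_P: "distr ?P \<mu> (\<lambda>x. x i) = \<mu>" and distr_Q: "distr ?Q \<nu> (\<lambda>x. x j) = \<nu>"
      using ij \<mu> \<nu> distr_PiM_component[of "{..<n}" "\<lambda>_. \<mu>" i]
        distr_PiM_component[of "{..<m}" "\<lambda>_. \<nu>" j] by auto
    have "(\<integral>s. q (fst s i, snd s j) \<partial>S) = (\<integral>x. (\<integral>x'. q (x i, x' j) \<partial>?Q) \<partial>?P)"
      using PQ.integral_fst'[OF int[OF ij, unfolded two_samples_def]]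
      by (simp add: two_samples_def)
    also have "\<dots> = (\<integral>x. (\<integral>y. q (x i, y) \<partial>\<nu>) \<partial>?P)"
    proof (rule Bochner_Integration.integral_cong[OF refl])
      fix x assume "x \<in> space ?P"
      then have [measurable]: "x i \<in> space \<mu>"
        using measurable_space[OF comp_P] by simp
      have "(\<lambda>y. q (x i, y)) \<in> borel_measurable \<nu>" by measurable
      from integral_distr[OF comp_Q this]
      show "(\<integral>x'. q (x i, x' j) \<partial>?Q) = (\<integral>y. q (x i, y) \<partial>\<nu>)"
        unfolding distr_Q ..
    qed
    also have "\<dots> = (\<integral>x. (\<integral>y. q (x, y) \<partial>\<nu>) \<partial>\<mu>)"
    proof -
      have "(\<lambda>x. \<integral>y. q (x, y) \<partial>\<nu>) \<in> borel_measurable \<mu>" by measurable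
      from integral_distr[OF comp_P this] show ?thesis unfolding distr_P ..
    qed
    finally show ?thesis .
  qed
  note pick = this
  have "S.expectation (\<lambda>s. \<Sum>i<n. \<Sum>j<m. q (fst s i, snd s j))
      = (\<Sum>i<n. \<Sum>j<m. S.expectation (\<lambda>s. q (fst s i, snd s j)))"
    using int by (subst Bochner_Integration.integral_sum)
      (auto intro!: sum.cong Bochner_Integration.integral_sum)
  also have "\<dots> = (\<Sum>i<n. \<Sum>j<m. \<integral>x. (\<integral>y. q (x, y) \<partial>\<nu>) \<partial>\<mu>)"
    by (intro sum.cong refl pick) auto
  finally have "S.expectation (emp q)
      = 1 / (real n * real m) * (\<Sum>i<n. \<Sum>j<m. \<integral>x. (\<integral>y. q (x, y) \<partial>\<nu>) \<partial>\<mu>)"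
    by (simp only: emp_def[abs_def] integral_mult_right_zero)
  then show ?thesis unfolding double_mean_const .
qed

section \<open>Integrals of the deviation bound\<close>

lemma integrable_ghost_bound [simp]: "integrable (S \<Otimes>\<^sub>M S) ghost_bound"
  by (rule SS.integrable_const_bound[of _ "4 * K"]) (use ghost_bound_abs_le in auto)

lemma integrable_ghost_bound' [simp]: "s \<in> space S \<Longrightarrow> integrable S (\<lambda>t. ghost_bound (s, t))"
  by (rule S.integrable_const_bound[of _ "4 * K"]) (use ghost_bound_abs_le in auto)

lemma measurable_deviation_bound [measurable]: "deviation_bound \<in> borel_measurable S"
  unfolding deviation_bound_def[abs_def] by measurable

lemma deviation_bound_abs_le: "s \<in> space S \<Longrightarrow> \<bar>deviation_bound s\<bar> \<le> 4 * K"
  unfolding deviation_bound_def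
  by (rule S.integral_abs_le_const) (use ghost_bound_abs_le in auto)

lemma integrable_deviation_bound [simp]: "integrable S deviation_bound"
  by (rule S.integrable_const_bound[of _ "4 * K"]) (use deviation_bound_abs_le in auto)

text \<open>For each fixed sign pattern, selection from sample and ghost sample preserves the
  two-sample law, so it disappears under the integral. The outer factor 4, against the 2 in the
  empirical complexity, leaves a factor 2.\<close>

lemma expectation_deviation_bound:
  "S.expectation deviation_bound = 2 * bipartite_rademacher n m \<mu> \<nu> \<Q>"
proof -
  have int: "integrable S (bipartite_sup n m \<Q> \<sigma> \<upsilon>)" if "(\<sigma>, \<upsilon>) \<in> set_pmf signs" for \<sigma> \<upsilon>
    by (rule S.integrable_const_bound[of _ K]) (use bipartite_sup_abs_le that in auto)
  have distr: "distr (S \<Otimes>\<^sub>M S) S (select_samples n m \<sigma> \<upsilon>) = S" for \<sigma> \<upsilon>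
    by (rule distr_select_samples[OF \<mu> \<nu>])
  have int': "integrable (S \<Otimes>\<^sub>M S) (\<lambda>z. bipartite_sup n m \<Q> \<sigma> \<upsilon> (select_samples n m \<sigma> \<upsilon> z))"
    and eq: "(\<integral>z. bipartite_sup n m \<Q> \<sigma> \<upsilon> (select_samples n m \<sigma> \<upsilon> z) \<partial>(S \<Otimes>\<^sub>M S))
      = (\<integral>s. bipartite_sup n m \<Q> \<sigma> \<upsilon> s \<partial>S)"
    if "(\<sigma>, \<upsilon>) \<in> set_pmf signs" for \<sigma> \<upsilon>
    using integrable_distr_eq[OF measurable_select_samples measurable_bipartite_sup[OF that], of \<sigma> \<upsilon>]
      integral_distr[OF measurable_select_samples measurable_bipartite_sup[OF that], of \<sigma> \<upsilon>]
      int[OF that] unfolding distr by simp_all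
  have "S.expectation deviation_bound = (\<integral>z. ghost_bound z \<partial>(S \<Otimes>\<^sub>M S))"
    unfolding deviation_bound_def[abs_def] by (rule SS.integral_fst') simp
  also have "\<dots> = 4 * (\<Sum>a\<in>set_pmf signs. pmf signs a *
      (\<integral>z. (case a of (\<sigma>, \<upsilon>) \<Rightarrow> bipartite_sup n m \<Q> \<sigma> \<upsilon> (select_samples n m \<sigma> \<upsilon> z)) \<partial>(S \<Otimes>\<^sub>M S)))"
    unfolding ghost_bound_def[abs_def] expectation_signs_sum
    using int' by (subst integral_mult_right_zero, subst Bochner_Integration.integral_sum) auto
  also have "\<dots> = 4 * (\<Sum>a\<in>set_pmf signs. pmf signs a *
      (\<integral>s. (case a of (\<sigma>, \<upsilon>) \<Rightarrow> bipartite_sup n m \<Q> \<sigma> \<upsilon> s) \<partial>S))"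
    by (intro arg_cong2[of _ _ _ _ "(*)"] refl sum.cong) (use eq in auto)
  also have "\<dots> = 4 * (\<integral>s. measure_pmf.expectation signs
      (\<lambda>(\<sigma>, \<upsilon>). bipartite_sup n m \<Q> \<sigma> \<upsilon> s) \<partial>S)"
    unfolding expectation_signs_sum
    using int by (subst Bochner_Integration.integral_sum) auto
  also have "\<dots> = 2 * bipartite_rademacher n m \<mu> \<nu> \<Q>"
    unfolding bipartite_rademacher_def empirical_bipartite_rademacher_def by simp
  finally show ?thesis .
qed

text \<open>Integrate the pointwise ghost inequality over \<open>t\<close>.\<close>

lemma deviation_le:
  assumes "q \<in> \<Q>" "s \<in> space S"
  shows "S.expectation (emp q) - emp q s \<le> deviation_bound s"
proof -
  have "S.expectation (emp q) - emp q s = (\<integral>t. emp q t - emp q s \<partial>S)"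
    using assms by (simp add: S.prob_space)
  also have "\<dots> \<le> deviation_bound s"
    unfolding deviation_bound_def
    using assms by (intro integral_mono emp_diff_le_ghost_bound) auto
  finally show ?thesis .
qed

text \<open>The deviation bound dominates the deviation of a fixed \<open>q\<close>, which has mean
  0.\<close>

lemma bipartite_rademacher_nonneg: "0 \<le> bipartite_rademacher n m \<mu> \<nu> \<Q>"
proof -
  obtain q where q: "q \<in> \<Q>" using nonempty by auto
  have "0 = S.expectation (\<lambda>s. S.expectation (emp q) - emp q s)"
    using q by (simp add: S.prob_space)
  also have "\<dots> \<le> S.expectation deviation_bound"
    using q by (intro integral_mono deviation_le) auto
  finally show ?thesis by (simp add: expectation_deviation_bound)
qed

section \<open>Concentration of the deviation bound\<close>

lemma deviation_bound_diff_le: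
  assumes "s \<in> space S" "s' \<in> space S"
  shows "\<bar>deviation_bound s - deviation_bound s'\<bar> \<le> K * disagreement s s'"
  unfolding deviation_bound_def
  using assms by (intro S.integral_diff_abs_le ghost_bound_diff_le) auto

text \<open>
  Subtracting the deviation of the fixed \<open>q0\<close> before applying McDiarmid's inequality, rather than
  treating it separately, avoids a union bound and hence a \<open>ln (2 / \<delta>)\<close>.
\<close>

lemma uniform_deviation:
  assumes q0: "q0 \<in> \<Q>" and \<delta>: "\<delta> \<in> {0<..<1}" and K: "K > 0"
  shows "\<exists>E\<in>sets S. S.prob E \<ge> 1 - \<delta> \<and> (\<forall>s\<in>E. \<forall>q\<in>\<Q>.
    (S.expectation (emp q) - emp q s) - (S.expectation (emp q0) - emp q0 s)
    \<le> 2 * bipartite_rademacher n m \<mu> \<nu> \<Q>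
      + K * sqrt (2 * (real n + real m) * ln (1 / \<delta>) / (real n * real m)))"
proof -
  define f where "f s = deviation_bound s - (S.expectation (emp q0) - emp q0 s)" for s
  \<comment> \<open>One point of the first sample moves the deviation bound by at most K / n and
    \<open>emp q0\<close> by as much, together 2 K / n; likewise 2 K / m for the second
    sample.\<close>
  define v where "v = real n * (2 * K / real n)\<^sup>2 + real m * (2 * K / real m)\<^sup>2"
  have [measurable]: "emp q0 \<in> borel_measurable S" by (rule measurable_emp[OF q0])
  have f[measurable]: "f \<in> borel_measurable S"
    unfolding f_def[abs_def] by measurable
  have f_diff: "\<bar>f s - f s'\<bar> \<le> 2 * K * disagreement s s'" if "s \<in> space S" "s' \<in> space S" for s s'
    using deviation_bound_diff_le[OF that] emp_diff_le[OF q0, of s s'] unfolding f_def by linarith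
  have space: "s \<in> space S \<longleftrightarrow> fst s \<in> space (\<Pi>\<^sub>M i\<in>{..<n}. \<mu>) \<and> snd s \<in> space (\<Pi>\<^sub>M j\<in>{..<m}. \<nu>)" for s
    by (cases s) (simp add: two_samples_def space_pair_measure)
  have upd: "x(i := y) \<in> space (\<Pi>\<^sub>M i\<in>{..<k}. \<kappa>)"
    if "x \<in> space (\<Pi>\<^sub>M i\<in>{..<k}. \<kappa>)" "i < k" "y \<in> space \<kappa>" for x y i and k :: nat and \<kappa> :: "'a measure"
    using that by (auto simp: space_PiM PiE_iff extensional_def)
  have "subgaussian_mgf S f v"
    unfolding v_def
  proof (rule mcdiarmid_two_samples[OF \<mu> \<nu>, folded two_samples_def])
    show "f \<in> borel_measurable S" by (rule f)
    show "\<bar>f s\<bar> \<le> 4 * K + \<bar>S.expectation (emp q0)\<bar> + K" if "s \<in> space S" for s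
      using deviation_bound_abs_le[OF that] emp_abs_le[OF q0, of s] unfolding f_def by linarith
    show "\<bar>f (x(i := y), x') - f (x, x')\<bar> \<le> 2 * K / real n"
      if "i < n" "x \<in> space (\<Pi>\<^sub>M i\<in>{..<n}. \<mu>)" "x' \<in> space (\<Pi>\<^sub>M j\<in>{..<m}. \<nu>)" "y \<in> space \<mu>" for i x x' y
    proof -
      have "\<bar>f (x(i := y), x') - f (x, x')\<bar> \<le> 2 * K * disagreement (x(i := y), x') (x, x')"
        by (rule f_diff) (use that upd in \<open>simp_all add: space\<close>)
      also have "\<dots> \<le> 2 * K * (1 / real n)"
        using K disagreement_upd_fst[OF that(1)] by (intro mult_left_mono) auto
      finally show ?thesis by simp
    qed
    show "\<bar>f (x, x'(j := y)) - f (x, x')\<bar> \<le> 2 * K / real m"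
      if "j < m" "x \<in> space (\<Pi>\<^sub>M i\<in>{..<n}. \<mu>)" "x' \<in> space (\<Pi>\<^sub>M j\<in>{..<m}. \<nu>)" "y \<in> space \<nu>" for j x x' y
    proof -
      have "\<bar>f (x, x'(j := y)) - f (x, x')\<bar> \<le> 2 * K * disagreement (x, x'(j := y)) (x, x')"
        by (rule f_diff) (use that upd in \<open>simp_all add: space\<close>)
      also have "\<dots> \<le> 2 * K * (1 / real m)"
        using K disagreement_upd_snd[OF that(1)] by (intro mult_left_mono) auto
      finally show ?thesis by simp
    qed
  qed
  moreover have v: "v = 4 * K\<^sup>2 * (real n + real m) / (real n * real m)"
    using n_pos m_pos by (simp add: v_def field_simps power2_eq_square)
  moreover have "v > 0"
    using n_pos m_pos K by (simp add: v)
  ultimately have tail: "S.prob {s\<in>space S. f s \<le> S.expectation f + sqrt (v * ln (1 / \<delta>) / 2)} \<ge> 1 - \<delta>"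
    using \<delta> f by (intro S.subgaussian_mgf_tail) auto
  have "v * ln (1 / \<delta>) / 2 = K\<^sup>2 * (2 * (real n + real m) * ln (1 / \<delta>) / (real n * real m))"
  proof -
    have "4 * a * b / c * d / 2 = a * (2 * b * d / c)" for a b c d :: real by simp
    then show ?thesis unfolding v by this
  qed
  then have root: "sqrt (v * ln (1 / \<delta>) / 2)
      = K * sqrt (2 * (real n + real m) * ln (1 / \<delta>) / (real n * real m))"
    using K by (simp only: real_sqrt_mult real_sqrt_abs abs_of_pos)
  \<comment> \<open>The subtracted deviation of \<open>q0\<close> has mean 0.\<close>
  have mean: "S.expectation f = 2 * bipartite_rademacher n m \<mu> \<nu> \<Q>"
    unfolding f_def[abs_def] using q0 by (simp add: expectation_deviation_bound S.prob_space)
  show ?thesis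
  proof (intro bexI conjI ballI)
    fix s q
    assume s: "s \<in> {s\<in>space S. f s \<le> S.expectation f + sqrt (v * ln (1 / \<delta>) / 2)}" and q: "q \<in> \<Q>"
    \<comment> \<open>The event is defined by \<open>f\<close> alone, so the inequality holds on it
      for all \<open>q\<close> simultaneously, including a \<open>q\<close> chosen from the
      data.\<close>
    then have "S.expectation (emp q) - emp q s \<le> deviation_bound s"
      by (intro deviation_le) auto
    then show "(S.expectation (emp q) - emp q s) - (S.expectation (emp q0) - emp q0 s)
        \<le> 2 * bipartite_rademacher n m \<mu> \<nu> \<Q>
          + K * sqrt (2 * (real n + real m) * ln (1 / \<delta>) / (real n * real m))"
      using s unfolding mean root f_def by simp
  qed (use tail in measurable)
qed

end

section \<open>The excess risk bound\<close>

theorem theorem5: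
  fixes M :: "'a measure" and pP pN :: "'a \<Rightarrow> real"
    and \<theta> \<theta>' K \<delta> :: real and l :: "real \<Rightarrow> real"
    and G :: "('a \<Rightarrow> real) set" and nCP nCN :: nat
    and ghat :: "(nat \<Rightarrow> 'a) \<times> (nat \<Rightarrow> 'a) \<Rightarrow> 'a \<Rightarrow> real" and gstar :: "'a \<Rightarrow> real"
  defines "P \<equiv> law M pP" and "N \<equiv> law M pN"
    and "CP \<equiv> law M (mixture \<theta> pP pN)" and "CN \<equiv> law M (mixture \<theta>' pP pN)"
  assumes "prob_density M pP" and "prob_density M pN"
    and "\<theta> \<in> {0..1}" and "\<theta>' \<in> {0..1}" and "\<theta> > \<theta>'"
    and "K > 0" and "symmetric_loss K l" and "\<And>z. l z \<in> {0..K}"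
    and "l \<in> borel_measurable borel"
    and "\<And>g. g \<in> G \<Longrightarrow> g \<in> borel_measurable M"
    and "nCP > 0" and "nCN > 0"
    and "bipartite_rademacher_well_defined nCP nCN CP CN (loss_class l G)"
    and "\<And>s. s \<in> space (two_samples nCP nCN CP CN) \<Longrightarrow>
           is_arg_min (empirical_auc_risk nCP nCN l s) (\<lambda>g. g \<in> G) (ghat s)"
    and "is_arg_min (auc_risk P N l) (\<lambda>g. g \<in> G) gstar"
    and "\<delta> \<in> {0<..<1}"
  shows "\<exists>E \<in> sets (two_samples nCP nCN CP CN).
           measure (two_samples nCP nCN CP CN) E \<ge> 1 - \<delta> \<and>
           (\<forall>s\<in>E. auc_risk P N l (ghat s) - auc_risk P N l gstar
              \<le> 1 / (\<theta> - \<theta>') *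
                  (K * sqrt (2 * (real nCP + real nCN) * ln (1 / \<delta>) / (real nCP * real nCN)))
                + 4 * bipartite_rademacher nCP nCN CP CN (loss_class l G) / (\<theta> - \<theta>'))"
proof -
  note pP = assms(5) and pN = assms(6) and \<theta> = assms(7,8) and \<theta>_less = assms(9)
    and K = assms(10) and sym = assms(11) and rng = assms(12) and l = assms(13)
    and G = assms(14) and pos = assms(15,16) and wd = assms(17) and ghat = assms(18)
    and gstar = assms(19) and \<delta> = assms(20)
  note defs = assms(1-4)
  let ?Q = "\<lambda>g :: 'a \<Rightarrow> real. \<lambda>(x, x'). l (g x - g x')"
  have gstar_G: "gstar \<in> G"
    using gstar by (simp add: is_arg_min_def)
  interpret bipartite_class nCP nCN CP CN "loss_class l G" K
  proof (rule bipartite_class.intro)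
    show "prob_space CP" "prob_space CN"
      unfolding defs by (intro prob_space_law prob_density_mixture pP pN \<theta>)+
    show "loss_class l G \<noteq> {}"
      using gstar_G by (auto simp: loss_class_def)
    show "q z \<in> {0..K}" if "q \<in> loss_class l G" for q z
      using that rng by (cases z) (auto simp: loss_class_def)
    show "q \<in> borel_measurable (CP \<Otimes>\<^sub>M CN)" if "q \<in> loss_class l G" for q
    proof -
      obtain g where g: "g \<in> G" "q = ?Q g"
        using \<open>q \<in> loss_class l G\<close> by (auto simp: loss_class_def)
      note [measurable] = G[OF g(1)] l
      show ?thesis unfolding g(2) defs by measurable
    qed
  qed (use pos wd in auto)
  have in_class: "?Q g \<in> loss_class l G" if "g \<in> G" for g
    using that by (auto simp: loss_class_def)
  have emp: "emp (?Q g) s = empirical_auc_risk nCP nCN l s g" for g s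
    by (simp add: emp_def empirical_auc_risk_def)
  \<comment> \<open>The expected corrupted risk is affine in the clean risk with slope \<theta> -
    \<theta>'; its constant cancels when two functions are compared.\<close>
  have risk: "S.expectation (emp (?Q g))
      = (\<theta> - \<theta>') * auc_risk P N l g + (1 - \<theta> + \<theta>') * K / 2" if "g \<in> G" for g
    using auc_risk_mixture[OF pP pN \<theta> G[OF that] l sym rng] expectation_emp[OF in_class[OF that]]
    unfolding defs by (simp add: auc_risk_def)
  let ?t = "K * sqrt (2 * (real nCP + real nCN) * ln (1 / \<delta>) / (real nCP * real nCN))"
  let ?R = "bipartite_rademacher nCP nCN CP CN (loss_class l G)"
  obtain E where E: "E \<in> sets S" "S.prob E \<ge> 1 - \<delta>"
    and dev: "\<And>s q. s \<in> E \<Longrightarrow> q \<in> loss_class l G \<Longrightarrow>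
      (S.expectation (emp q) - emp q s)
        - (S.expectation (emp (?Q gstar)) - emp (?Q gstar) s) \<le> 2 * ?R + ?t"
    using uniform_deviation[OF in_class[OF gstar_G] \<delta> K] by blast
  have "auc_risk P N l (ghat s) - auc_risk P N l gstar
      \<le> 1 / (\<theta> - \<theta>') * ?t + 4 * ?R / (\<theta> - \<theta>')" if s: "s \<in> E" for s
  proof -
    have "s \<in> space S"
      using s E(1) sets.sets_into_space by blast
    from ghat[OF this] have min: "ghat s \<in> G" "emp (?Q (ghat s)) s \<le> emp (?Q gstar) s"
      using gstar_G unfolding emp by (auto simp: is_arg_min_def not_less)
    have "(\<theta> - \<theta>') * (auc_risk P N l (ghat s) - auc_risk P N l gstar)
        = S.expectation (emp (?Q (ghat s))) - S.expectation (emp (?Q gstar))"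
      by (simp add: risk min(1) gstar_G right_diff_distrib)
    \<comment> \<open>Adding \<open>emp (?Q gstar) s - emp (?Q (ghat s)) s\<close>, nonnegative by
      empirical minimality, turns the excess into a difference of deviations. Then
      \<open>dev\<close> applies with the data-dependent \<open>ghat s\<close>.\<close>
    also have "\<dots> \<le> 2 * ?R + ?t"
      using dev[OF s in_class[OF min(1)]] min(2) by linarith
    \<comment> \<open>Nonnegativity of the complexity relaxes the factor 2 to 4.\<close>
    also have "\<dots> \<le> ?t + 4 * ?R"
      using bipartite_rademacher_nonneg by linarith
    finally have "auc_risk P N l (ghat s) - auc_risk P N l gstar \<le> (?t + 4 * ?R) / (\<theta> - \<theta>')"
      using \<theta>_less by (simp add: pos_le_divide_eq mult.commute)
    then show ?thesis
      by (simp add: add_divide_distrib)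
  qed
  with E show ?thesis by blast
qed

end
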